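(* Let $\mathcal R$ be a bounded-size $\ell$-vertex rule with critical time $t_{\mathrm c}>0$, limiting susceptibility functions $(s_r)_{r\ge2}$, period $p_{\mathcal R}\ge1$, and associated functions $\theta,\psi$ (all defined in the context). Let $$B_r:=(2r-5)!!\cdot\frac{\sqrt{2\pi}\,\theta(t_{\mathrm c})}{p_{\mathcal R}}\cdot\psi''(t_{\mathrm c})^{-r+3/2}.$$ Then there exists a constant $\varepsilon_0>0$ such that, for all $r\ge2$ and $\varepsilon\in(0,\varepsilon_0)$, we have $B_r>0$ and $$s_r(t_{\mathrm c}-\varepsilon)=(1+O(\varepsilon))\,B_r\,\varepsilon^{-2r+3},$$ where the implicit constant may depend on $r$ and $\mathcal R$ but not on $\varepsilon$.
   Context: Bounded-size $\ell$-vertex rule with cut-off $K$ (integers $\ell\ge2$, $K\ge1$): a function $\mathcal R:\{1,\dots,K+1\}^\ell\to\binom{[\ell]}{2}$. For each $n$ it yields a random sequence of (multi)graphs $(G_i)_{i\ge0}$ on vertex set $[n]$: $G_0$ has no edges; in step $i\ge1$ vertices $v_{i,1},\dots,v_{i,\ell}$ are drawn independently and uniformly at random from $[n]$, and $G_i$ is obtained from $G_{i-1}$ by adding the edge $v_{i,j_1}v_{i,j_2}$, where $\{j_1,j_2\}=\mathcal R(\min\{c_{i,1},K+1\},\dots,\min\{c_{i,\ell},K+1\})$ and $c_{i,j}$ is the size of the component of $G_{i-1}$ containing $v_{i,j}$. $L_1(i)$ is the number of vertices in the largest component of $G_i$, $N_k(i)$ the number of vertices of $G_i$ in components with exactly $k$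 vertices, and $S_r(i)=\sum_{k\ge1}k^{r-1}N_k(i)/n$. Step indices such as $tn$ are rounded down to integers. Critical time: the (known to exist) constant $t_{\mathrm c}\in(0,\infty)$ such that for each fixed $t\ge0$, with probability tending to $1$, $L_1(tn)=O(\log n)$ if $t<t_{\mathrm c}$ and $L_1(tn)=\Theta(n)$ if $t>t_{\mathrm c}$. $\rho_k(t)$ ($t\ge0$, $k\ge1$) is the (known to exist) limit in probability of $N_k(tn)/n$; $s_r(t)$ ($0\le t<t_{\mathrm c}$, $r\ge2$) is the (known to exist) limit in probability of $S_r(tn)$. $\mathcal S_{\mathcal R}$ is the smallest set $\mathcal S$ of positive integers with $1\in\mathcal S$ such that $(c_1,\dots,c_\ell)\in\mathcal S^\ell$ implies $c_{j_1}+c_{j_2}\in\mathcal S$, where $\{j_1,j_2\}=\mathcal R(\min\{c_1,K+1\},\dots,\min\{c_\ell,K+1\})$. The period $p_{\mathcal R}$ is the unique positive integer such that, for all sufficiently large $k$, $k\in\mathcal S_{\mathcal R}$ if and only if $p_{\mathcal R}$ divides $k$ (it exists). The functions $\theta,\psi$: there exist $\varepsilon_1>0$ and non-negative real analytic functions $\theta,\psi$ on $I=[t_{\mathrm c}-\varepsilon_1,t_{\mathrm c}+\varepsilon_1]$ such that $\rho_k(t)=(1+O(1/k))\mathbf 1_{\{k\in\mathcal S_{\mathcal R}\}}k^{-3/2}\theta(t)e^{-\psi(t)k}$ uniformly in $k\ge1$ and $t\in I$, with $\theta(t_{\mathrm c}),\psi''(t_{\mathrm c})>0$ and $\psi(t_{\mathrm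 c})=\psi'(t_{\mathrm c})=0$. Double factorial convention: $x!!=\prod_{0\le j<\lceil x/2\rceil}(x-2j)$, equal to $1$ for $x\le0$. *)

theory Defs
  imports "HOL-Probability.Probability" "HOL-Library.Multiset"
begin

section \<open>Bounded-size rules\<close>

text \<open>The index set $[\ell]$ is \<^term>\<open>{1..l}\<close>; an $\ell$-tuple is an (extensional) function on it.\<close>

type_synonym rule = "(nat \<Rightarrow> nat) \<Rightarrow> nat set"

definition bounded_size_rule :: "nat \<Rightarrow> nat \<Rightarrow> rule \<Rightarrow> bool" where
  "bounded_size_rule l K R \<longleftrightarrow> 2 \<le> l \<and> 1 \<le> K \<and>
     R \<in> ({1..l} \<rightarrow>\<^sub>E {1..K + 1}) \<rightarrow> {e. e \<subseteq> {1..l} \<and> card e = 2}"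

text \<open>The pair $\{j_1, j_2\}$ selected when the $j$-th component has size \<open>c j\<close>.\<close>

definition selected_pair :: "nat \<Rightarrow> nat \<Rightarrow> rule \<Rightarrow> (nat \<Rightarrow> nat) \<Rightarrow> nat set" where
  "selected_pair l K R c = R (\<lambda>j\<in>{1..l}. min (c j) (K + 1))"

section \<open>The random multigraph process\<close>

text \<open>A multigraph on $[n]$ is the multiset of its edges; a loop at \<open>x\<close> is the edge \<open>{x}\<close>.\<close>

type_synonym multigraph = "nat set multiset"

definition component :: "multigraph \<Rightarrow> nat \<Rightarrow> nat set" where
  "component G x = {y. (x, y) \<in> {(u, w). {u, w} \<in># G}\<^sup>*}"

text \<open>\<open>v (i, j)\<close> is the \<open>j\<close>-th vertex drawn in step \<open>i \<ge> 1\<close>.\<close>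

primrec graph_at :: "nat \<Rightarrow> nat \<Rightarrow> rule \<Rightarrow> (nat \<times> nat \<Rightarrow> nat) \<Rightarrow> nat \<Rightarrow> multigraph" where
  "graph_at l K R v 0 = {#}"
| "graph_at l K R v (Suc i) =
     (let G = graph_at l K R v i;
          J = selected_pair l K R (\<lambda>j. card (component G (v (Suc i, j))))
      in add_mset ((\<lambda>j. v (Suc i, j)) ` J) G)"

definition draws :: "nat \<Rightarrow> nat \<Rightarrow> (nat \<times> nat \<Rightarrow> nat) measure" where
  "draws l n = PiM ({1..} \<times> {1..l}) (\<lambda>_. uniform_count_measure {1..n})"

definition largest_component :: "nat \<Rightarrow> multigraph \<Rightarrow> nat" where
  "largest_component n G = Max ((\<lambda>x. card (component G x)) ` {1..n})"

definition vertices_in_size :: "nat \<Rightarrow> nat \<Rightarrow> multigraph \<Rightarrow> nat" where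
  "vertices_in_size n k G = card {x \<in> {1..n}. card (component G x) = k}"

text \<open>No component has more than \<open>n\<close> vertices, so the sum over all $k \ge 1$ stops at \<open>n\<close>.\<close>

definition susceptibility :: "nat \<Rightarrow> nat \<Rightarrow> multigraph \<Rightarrow> real" where
  "susceptibility n r G =
     (\<Sum>k = 1..n. real k ^ (r - 1) * real (vertices_in_size n k G) / real n)"

definition graph_at_time ::
  "nat \<Rightarrow> nat \<Rightarrow> rule \<Rightarrow> real \<Rightarrow> nat \<Rightarrow> (nat \<times> nat \<Rightarrow> nat) \<Rightarrow> multigraph" where
  "graph_at_time l K R t n v = graph_at l K R v (nat \<lfloor>t * real n\<rfloor>)"

section \<open>Limits\<close>

text \<open>The probability space varies with \<open>n\<close>.\<close>

definition whp :: "(nat \<Rightarrow> 'a measure) \<Rightarrow> (nat \<Rightarrow> 'a \<Rightarrow> bool) \<Rightarrow> bool" where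
  "whp M P \<longleftrightarrow> (\<lambda>n. measure (M n) {\<omega> \<in> space (M n). P n \<omega>}) \<longlonglongrightarrow> 1"

definition limit_in_probability ::
  "(nat \<Rightarrow> 'a measure) \<Rightarrow> (nat \<Rightarrow> 'a \<Rightarrow> real) \<Rightarrow> real \<Rightarrow> bool" where
  "limit_in_probability M X x \<longleftrightarrow>
     (\<forall>\<delta>>0. (\<lambda>n. measure (M n) {\<omega> \<in> space (M n). \<bar>X n \<omega> - x\<bar> > \<delta>}) \<longlonglongrightarrow> 0)"

definition is_critical_time :: "nat \<Rightarrow> nat \<Rightarrow> rule \<Rightarrow> real \<Rightarrow> bool" where
  "is_critical_time l K R tc \<longleftrightarrow> 0 < tc \<and>
     (\<forall>t. 0 \<le> t \<and> t < tc \<longrightarrow> (\<exists>C>0. whp (draws l) (\<lambda>n v.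
        real (largest_component n (graph_at_time l K R t n v)) \<le> C * ln (real n)))) \<and>
     (\<forall>t>tc. \<exists>c>0. \<exists>C>0. whp (draws l) (\<lambda>n v.
        c * real n \<le> real (largest_component n (graph_at_time l K R t n v)) \<and>
        real (largest_component n (graph_at_time l K R t n v)) \<le> C * real n))"

definition is_limit_size_density ::
  "nat \<Rightarrow> nat \<Rightarrow> rule \<Rightarrow> (nat \<Rightarrow> real \<Rightarrow> real) \<Rightarrow> bool" where
  "is_limit_size_density l K R \<rho> \<longleftrightarrow>
     (\<forall>k\<ge>1. \<forall>t\<ge>0. limit_in_probability (draws l)
        (\<lambda>n v. real (vertices_in_size n k (graph_at_time l K R t n v)) / real n) (\<rho> k t))"

definition is_limit_susceptibility ::
  "nat \<Rightarrow> nat \<Rightarrow> rule \<Rightarrow> real \<Rightarrow> (nat \<Rightarrow> real \<Rightarrow> real) \<Rightarrow> bool" where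
  "is_limit_susceptibility l K R tc s \<longleftrightarrow>
     (\<forall>r\<ge>2. \<forall>t. 0 \<le> t \<and> t < tc \<longrightarrow> limit_in_probability (draws l)
        (\<lambda>n v. susceptibility n r (graph_at_time l K R t n v)) (s r t))"

section \<open>Attainable sizes, the period, and the associated functions\<close>

inductive_set attainable_sizes :: "nat \<Rightarrow> nat \<Rightarrow> rule \<Rightarrow> nat set"
  for l K :: nat and R :: rule where
  one: "1 \<in> attainable_sizes l K R"
| merge: "(\<And>j. j \<in> {1..l} \<Longrightarrow> c j \<in> attainable_sizes l K R) \<Longrightarrow>
    (\<Sum>j\<in>selected_pair l K R c. c j) \<in> attainable_sizes l K R"

definition period :: "nat \<Rightarrow> nat \<Rightarrow> rule \<Rightarrow> nat" where
  "period l K R = (THE p. 0 < p \<and>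
     (\<forall>\<^sub>F k in sequentially. k \<in> attainable_sizes l K R \<longleftrightarrow> p dvd k))"

text \<open>
  The expansion is only required to represent \<open>f\<close> on \<open>S\<close>. At an endpoint of a nondegenerate
  closed interval its radius of convergence is still positive, so this says that \<open>f\<close>
  restricted to \<open>S\<close> extends analytically across the endpoint, whatever the values of the total
  function \<open>f\<close> outside \<open>S\<close>.
\<close>

definition real_analytic_on :: "(real \<Rightarrow> real) \<Rightarrow> real set \<Rightarrow> bool" where
  "real_analytic_on f S \<longleftrightarrow> (\<forall>x\<in>S. \<exists>d>0. \<exists>a :: nat \<Rightarrow> real.
     \<forall>y\<in>S. \<bar>y - x\<bar> < d \<longrightarrow> (\<lambda>m. a m * (y - x) ^ m) sums f y)"

definition are_associated_functions ::
  "nat \<Rightarrow> nat \<Rightarrow> rule \<Rightarrow> real \<Rightarrow> (nat \<Rightarrow> real \<Rightarrow> real) \<Rightarrow>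
   (real \<Rightarrow> real) \<Rightarrow> (real \<Rightarrow> real) \<Rightarrow> bool" where
  "are_associated_functions l K R tc \<rho> \<theta> \<psi> \<longleftrightarrow>
     (\<exists>\<epsilon>1>0. let I = {tc - \<epsilon>1..tc + \<epsilon>1} in
        real_analytic_on \<theta> I \<and> real_analytic_on \<psi> I \<and>
        (\<forall>t\<in>I. 0 \<le> \<theta> t \<and> 0 \<le> \<psi> t) \<and>
        (\<exists>C. \<forall>k\<ge>1. \<forall>t\<in>I. \<exists>\<eta>. \<bar>\<eta>\<bar> \<le> C / real k \<and>
           \<rho> k t = (1 + \<eta>) * indicator (attainable_sizes l K R) k *
             real k powr (- 3 / 2) * \<theta> t * exp (- \<psi> t * real k))) \<and>
     \<theta> tc > 0 \<and> deriv (deriv \<psi>) tc > 0 \<and> \<psi> tc = 0 \<and> deriv \<psi> tc = 0"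

section \<open>The leading constant\<close>

definition double_factorial :: "int \<Rightarrow> int" where
  "double_factorial x = (\<Prod>j \<in> {0..<\<lceil>real_of_int x / 2\<rceil>}. x - 2 * j)"

definition susceptibility_constant ::
  "nat \<Rightarrow> nat \<Rightarrow> rule \<Rightarrow> real \<Rightarrow> (real \<Rightarrow> real) \<Rightarrow> (real \<Rightarrow> real) \<Rightarrow> nat \<Rightarrow> real" where
  "susceptibility_constant l K R tc \<theta> \<psi> r =
     real_of_int (double_factorial (2 * int r - 5)) *
     (sqrt (2 * pi) * \<theta> tc / real (period l K R)) *
     deriv (deriv \<psi>) tc powr (- real r + 3 / 2)"

end

theory Submission imports Defs begin

text \<open>
  The tail \<open>k > M\<close> of $S_r$ is at most $S_{r+1}/M$, and $S_{r+1}$ converges in probability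
  too; hence $s_r(t) = \sum_k k^{r-1}\rho_k(t)$ for $t < t_c$. Put $a = r - 3/2$ and
  $x = \psi(t)$. Inserting the asymptotics of $\rho_k$ turns $x^a s_r(t)/\theta(t)$ into a Riemann
  sum of mesh $x$, over the multiples of the period, for the integral of $u^{a-1}e^{-u}$. It equals
  $\Gamma(a)/p + O(\sqrt x)$: the factors $1 + O(1/k)$, the exceptional small sizes, the
  singularity at $0$ and the mesh all contribute only $O(\sqrt x)$, since
  $\sum_k k^{-3/2}$ converges. Finally $\psi(t_c - \varepsilon) =
  (1 + O(\varepsilon))\,\psi''(t_c)\varepsilon^2/2$ and
  $\theta(t_c - \varepsilon) = (1 + O(\varepsilon))\,\theta(t_c)$.
\<close>

section \<open>Susceptibilities as sums over component sizes\<close>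

text \<open>An error O(sqrt x) is exactly what is needed, since x = \<psi>(tc - \<epsilon>) is of
  order \<epsilon>^2. The obstacle is that for r = 2 the integrand g(u) = u^(a-1) e^(-u) is
  unbounded at 0. All r are treated alike through g(u) \<le> C u^(-1/2) and |g'(u)| \<le> D
  u^(-3/2), which hold for every a \<ge> 1/2: the mesh cell starting at x j then costs x^2 (x
  j)^(-3/2) = sqrt x j^(-3/2), and a weight error C/k costs x (x k)^(-1/2) / k = sqrt x k^(-3/2).
  Only the cell at 0 needs a separate argument. The leading constant first appears as \<theta>(tc)
  b^(-a) Gamma(a) / p with b = \<psi>''(tc) / 2. The factor 2^a hidden in b^(-a) turns Gamma at a
  half-integer into (2r-5)!! sqrt(2 pi), and x^(-a) supplies \<epsilon>^(-2a) = \<epsilon>^(-2r+3).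
  The threshold has to serve all r at once, so it is fixed from \<theta> and \<psi> before r;
  whatever depends on r goes into the implicit constant.\<close>

lemma finite_component: "finite (component G x)"
proof -
  let ?r = "{(u, w). {u, w} \<in># G}"
  \<comment> \<open>The multiset may contain infinite sets, but none of them has the form {u, w}, so
    the finite ones cover all pairs.\<close>
  have "?r \<subseteq> (\<Union>e \<in> set_mset G \<inter> Collect finite. e \<times> e)"
  proof clarify
    fix u w assume "{u, w} \<in># G"
    then show "(u, w) \<in> (\<Union>e \<in> set_mset G \<inter> Collect finite. e \<times> e)"
      by (intro UN_I[of "{u, w}"]) auto
  qed
  moreover have "finite (\<Union>e \<in> set_mset G \<inter> Collect finite. e \<times> e)"
    by (intro finite_UN_I) auto
  ultimately have "finite ?r"
    by (rule finite_subset)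
  moreover have "component G x \<subseteq> insert x (Range ?r)"
    unfolding component_def by (auto elim: rtranclE)
  ultimately show ?thesis
    by (meson finite_Range finite_insert finite_subset)
qed

lemma card_component_pos: "0 < card (component G x)"
proof -
  have "x \<in> component G x"
    by (simp add: component_def)
  then show ?thesis
    using finite_component card_gt_0_iff by blast
qed

section \<open>Measurability of events of the graph process\<close>

lemma selected_pair_in:
  assumes "bounded_size_rule l K R" and "\<And>j. j \<in> {1..l} \<Longrightarrow> 0 < c j"
  shows "selected_pair l K R c \<subseteq> {1..l}" "card (selected_pair l K R c) = 2"
proof -
  have "(\<lambda>j\<in>{1..l}. min (c j) (K + 1)) \<in> {1..l} \<rightarrow>\<^sub>E {1..K + 1}"
    using assms(2) by (fastforce simp: Suc_le_eq)
  then have "selected_pair l K R c \<in> {e. e \<subseteq> {1..l} \<and> card e = 2}"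
    using assms(1) unfolding bounded_size_rule_def selected_pair_def by blast
  then show "selected_pair l K R c \<subseteq> {1..l}" "card (selected_pair l K R c) = 2"
    by auto
qed

text \<open>Sizes enter through a tuple restricted to {1..l}, and the selected pair stays inside
  {1..l}, so no draw with another index is ever read. This reduces measurability of graph events to
  finitely many coordinates.\<close>

lemma graph_at_cong:
  assumes R: "bounded_size_rule l K R" and "\<And>z. z \<in> {1..m} \<times> {1..l} \<Longrightarrow> v z = w z"
  shows "graph_at l K R v m = graph_at l K R w m"
  using assms(2)
proof (induction m)
  case (Suc m)
  let ?G = "graph_at l K R w m"
  have IH: "graph_at l K R v m = ?G"
    by (rule Suc.IH) (use Suc.prems in auto)
  have eq: "v (Suc m, j) = w (Suc m, j)" if "j \<in> {1..l}" for j
    using Suc.prems[of "(Suc m, j)"] that by auto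
  have J: "selected_pair l K R (\<lambda>j. card (component ?G (v (Suc m, j)))) =
      selected_pair l K R (\<lambda>j. card (component ?G (w (Suc m, j))))"
    unfolding selected_pair_def by (rule arg_cong[of _ _ R]) (auto simp: eq restrict_def)
  have "selected_pair l K R (\<lambda>j. card (component ?G (w (Suc m, j)))) \<subseteq> {1..l}"
    by (rule selected_pair_in[OF R card_component_pos])
  then show ?case
    by (simp add: Let_def IH J image_cong[OF refl eq] subset_eq cong: image_cong)
qed simp

text \<open>Finitely many coordinates take finitely many values each, so the event is a finite union
  of cylinders, one for each assignment on \<open>J\<close> that satisfies \<open>P\<close>.\<close>

lemma sets_draws_Collect:
  assumes fin: "finite J" and J: "J \<subseteq> {1..} \<times> {1..l}"
    and dep: "\<And>v w. (\<And>z. z \<in> J \<Longrightarrow> v z = w z) \<Longrightarrow> P v \<longleftrightarrow> P w"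
  shows "{v \<in> space (draws l n). P v} \<in> sets (draws l n)"
proof -
  let ?M = "draws l n"
  let ?W = "{w \<in> J \<rightarrow>\<^sub>E {1..n}. P w}"
  have sp: "v z \<in> {1..n}" if "v \<in> space ?M" "z \<in> J" for v z
    using that J unfolding draws_def by (auto simp: space_PiM space_uniform_count_measure)
  have "{v \<in> space ?M. P v} = (\<Union>w\<in>?W. {v \<in> space ?M. \<forall>z\<in>J. v z = w z})" (is "?L = ?R")
  proof
    show "?L \<subseteq> ?R"
    proof
      fix v assume v: "v \<in> ?L"
      have "P (restrict v J)"
        using dep[of v "restrict v J"] v by auto
      then have "restrict v J \<in> ?W"
        using sp v by auto
      then show "v \<in> ?R"
        using v by (intro UN_I[of "restrict v J"]) auto
    qed
    show "?R \<subseteq> ?L"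
      using dep by blast
  qed
  moreover have "?R \<in> sets ?M"
  proof (intro sets.finite_UN sets.sets_Collect_finite_All fin)
    show "finite ?W"
      using fin by (auto intro!: finite_PiE)
    fix w z assume "w \<in> ?W" and z: "z \<in> J"
    have m: "(\<lambda>v. v z) \<in> measurable ?M (uniform_count_measure {1..n})"
      unfolding draws_def using z J by (intro measurable_component_singleton) auto
    have "{v \<in> space ?M. v z = w z} = (\<lambda>v. v z) -` {w z} \<inter> space ?M"
      by auto
    also have "\<dots> \<in> sets ?M"
      using m z \<open>w \<in> ?W\<close> by (intro measurable_sets) (auto simp: sets_uniform_count_measure)
    finally show "{v \<in> space ?M. v z = w z} \<in> sets ?M" .
  qed 
  ultimately show ?thesis by simp
qed

lemma sets_draws_graph:
  assumes "bounded_size_rule l K R"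
  shows "{v \<in> space (draws l n). P (graph_at_time l K R t n v)} \<in> sets (draws l n)"
proof (rule sets_draws_Collect)
  show "P (graph_at_time l K R t n v) \<longleftrightarrow> P (graph_at_time l K R t n w)"
    if "\<And>z. z \<in> {1..nat \<lfloor>t * real n\<rfloor>} \<times> {1..l} \<Longrightarrow> v z = w z" for v w
    unfolding graph_at_time_def using graph_at_cong[OF assms that] by simp
qed auto

lemma prob_space_draws: "0 < n \<Longrightarrow> prob_space (draws l n)"
  unfolding draws_def by (intro prob_space_PiM prob_space_uniform_count_measure) auto

text \<open>Union bound: once the failure probabilities sum to less than 1, some outcome avoids
  every failure. Inequalities that hold for each outcome thereby carry over to the limits.\<close>

lemma limit_in_probability_simultaneous:
  assumes prob: "\<And>n. 0 < n \<Longrightarrow> prob_space (M n)" and fin: "finite \<X>"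
    and meas: "\<And>X x n \<delta>. (X, x) \<in> \<X> \<Longrightarrow> {\<omega> \<in> space (M n). \<bar>X n \<omega> - x\<bar> > \<delta>} \<in> sets (M n)"
    and lim: "\<And>X x. (X, x) \<in> \<X> \<Longrightarrow> limit_in_probability M X x" and "0 < (\<delta>::real)"
  shows "\<forall>\<^sub>F n in sequentially. \<exists>\<omega>. \<forall>(X, x) \<in> \<X>. \<bar>X n \<omega> - x\<bar> \<le> \<delta>"
proof -
  define B where "B = (\<lambda>n (X, x). {\<omega> \<in> space (M n). \<bar>X n \<omega> - x\<bar> > \<delta>})"
  have "(\<lambda>n. measure (M n) (B n z)) \<longlonglongrightarrow> 0" if "z \<in> \<X>" for z
    using lim[of "fst z" "snd z"] that \<open>0 < \<delta>\<close>
    unfolding limit_in_probability_def B_def by (auto simp: case_prod_beta)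
  then have "(\<lambda>n. \<Sum>z\<in>\<X>. measure (M n) (B n z)) \<longlonglongrightarrow> 0"
    by (rule tendsto_null_sum)
  then have "\<forall>\<^sub>F n in sequentially. (\<Sum>z\<in>\<X>. measure (M n) (B n z)) < 1"
    by (rule order_tendstoD(2)) simp
  then show ?thesis
    using eventually_gt_at_top[of 0]
  proof eventually_elim
    case (elim n)
    interpret prob_space "M n"
      using prob elim(2) .
    have "measure (M n) (\<Union>z\<in>\<X>. B n z) \<le> (\<Sum>z\<in>\<X>. measure (M n) (B n z))"
      using meas by (intro finite_measure_subadditive_finite fin) (auto simp: B_def)
    then have "(\<Union>z\<in>\<X>. B n z) \<noteq> space (M n)"
      using elim(1) prob_space by auto
    moreover have "(\<Union>z\<in>\<X>. B n z) \<subseteq> space (M n)"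
      by (auto simp: B_def)
    ultimately obtain \<omega> where "\<omega> \<in> space (M n)" "\<omega> \<notin> (\<Union>z\<in>\<X>. B n z)"
      by blast
    then show ?case
      by (intro exI[of _ \<omega>]) (auto simp: B_def not_less)
  qed
qed

lemma susceptibility_truncation:
  assumes "0 < M" "M \<le> n" "1 \<le> r"
  shows "\<bar>susceptibility n r G - (\<Sum>k = 1..M. real k ^ (r - 1) * (real (vertices_in_size n k G) / real n))\<bar>
    \<le> susceptibility n (r + 1) G / real M"
proof -
  let ?f = "\<lambda>r k. real k ^ (r - 1) * real (vertices_in_size n k G) / real n"
  have "susceptibility n r G = (\<Sum>k = 1..M. ?f r k) + (\<Sum>k = M+1..n. ?f r k)"
    unfolding susceptibility_def using assms
    by (subst sum.union_disjoint[symmetric]) (auto intro!: sum.cong)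
  moreover have "(\<Sum>k = M+1..n. ?f r k) \<ge> 0"
    by (intro sum_nonneg) auto
  moreover have "(\<Sum>k = M+1..n. ?f r k) \<le> susceptibility n (r + 1) G / real M"
  proof -
    have "?f r k \<le> ?f (r + 1) k / real M" if "k \<in> {M+1..n}" for k
    proof -
      have "real k ^ (r - 1) * real M \<le> real k ^ r"
        using that assms(3) by (subst power_eq_if) (auto intro!: mult_mono simp: mult.commute)
      then have "real k ^ (r - 1) * real M * (real (vertices_in_size n k G) / real n) \<le> real k ^ r * (real (vertices_in_size n k G) / real n)"
        by (rule mult_right_mono) auto
      then show ?thesis
        using assms by (simp add: field_simps)
    qed
    then have "(\<Sum>k = M+1..n. ?f r k) \<le> (\<Sum>k = M+1..n. ?f (r + 1) k / real M)"
      by (rule sum_mono)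
    also have "\<dots> \<le> (\<Sum>k = 1..n. ?f (r + 1) k / real M)"
      using assms by (intro sum_mono2) auto
    finally show ?thesis
      by (simp add: susceptibility_def sum_divide_distrib)
  qed
  ultimately show ?thesis by simp
qed

text \<open>At fixed M only finitely many convergences are involved, so the truncation inequality
  survives the limit in n. M tends to infinity only afterwards, and no limit in n is exchanged with
  an infinite sum.\<close>

lemma limit_susceptibility_sums:
  assumes R: "bounded_size_rule l K R" and \<rho>: "is_limit_size_density l K R \<rho>"
    and s: "is_limit_susceptibility l K R tc s" and r: "2 \<le> r" and t: "0 \<le> t" "t < tc"
  shows "(\<lambda>k. real k ^ (r - 1) * \<rho> k t) sums s r t"
proof -
  let ?G = "graph_at_time l K R t"
  let ?f = "\<lambda>k. real k ^ (r - 1) * \<rho> k t"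
  have bound: "\<bar>s r t - (\<Sum>k = 1..M. ?f k)\<bar> \<le> s (r + 1) t / real M" if M: "0 < M" for M
  proof (rule field_le_epsilon)
    fix e :: real assume "0 < e"
    \<comment> \<open>\<open>A\<close> adds up the weights with which \<delta> will enter: 1 from
      S_r, 1/M from the tail bound, k^(r-1) from each density. With \<delta> = e / A the total error
      is exactly e.\<close>
    define A where "A = 1 + 1 / real M + (\<Sum>k = 1..M. real k ^ (r - 1))"
    have "0 < A"
      unfolding A_def using M by (intro add_pos_nonneg sum_nonneg) auto
    define \<delta> where "\<delta> = e / A"
    have "0 < \<delta>"
      using \<open>0 < e\<close> \<open>0 < A\<close> by (simp add: \<delta>_def)
    define N where "N = (\<lambda>k n v. real (vertices_in_size n k (?G n v)) / real n)"
    define S where "S = (\<lambda>q n v. susceptibility n q (?G n v))"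
    define \<X> where "\<X> = {(S r, s r t), (S (r + 1), s (r + 1) t)} \<union> (\<lambda>k. (N k, \<rho> k t)) ` {1..M}"
    have "\<forall>\<^sub>F n in sequentially. \<exists>v. \<forall>(X, x) \<in> \<X>. \<bar>X n v - x\<bar> \<le> \<delta>"
    proof (rule limit_in_probability_simultaneous[where M = "draws l"])
      show "finite \<X>" by (simp add: \<X>_def)
      show "0 < \<delta>" by fact
      show "prob_space (draws l n)" if "0 < n" for n
        using prob_space_draws that .
      show "{v \<in> space (draws l n). \<bar>X n v - x\<bar> > d} \<in> sets (draws l n)" if "(X, x) \<in> \<X>" for X x n d
        using that unfolding \<X>_def S_def N_def by (auto intro!: sets_draws_graph[OF R])
      show "limit_in_probability (draws l) X x" if "(X, x) \<in> \<X>" for X x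
        using that s \<rho> r t
        unfolding \<X>_def S_def N_def is_limit_susceptibility_def is_limit_size_density_def by auto
    qed
    then have "\<forall>\<^sub>F n in sequentially. M \<le> n \<and> (\<exists>v. \<forall>(X, x) \<in> \<X>. \<bar>X n v - x\<bar> \<le> \<delta>)"
      by (rule eventually_conj[OF eventually_ge_at_top])
    then obtain n where "M \<le> n" and "\<exists>v. \<forall>(X, x) \<in> \<X>. \<bar>X n v - x\<bar> \<le> \<delta>"
      using eventually_happens'[OF sequentially_bot] by blast
    then obtain v where v: "\<And>X x. (X, x) \<in> \<X> \<Longrightarrow> \<bar>X n v - x\<bar> \<le> \<delta>"
      by blast
    have S: "\<bar>S r n v - s r t\<bar> \<le> \<delta>" "\<bar>S (r + 1) n v - s (r + 1) t\<bar> \<le> \<delta>"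
      using v by (auto simp: \<X>_def)
    have N: "\<bar>N k n v - \<rho> k t\<bar> \<le> \<delta>" if "k \<in> {1..M}" for k
      using v that by (auto simp: \<X>_def)
    have "\<bar>(\<Sum>k = 1..M. real k ^ (r - 1) * N k n v) - (\<Sum>k = 1..M. ?f k)\<bar> \<le>
        (\<Sum>k = 1..M. real k ^ (r - 1) * \<delta>)"
      unfolding sum_subtractf[symmetric]
      by (rule order_trans[OF sum_abs sum_mono])
         (auto simp: right_diff_distrib[symmetric] abs_mult intro!: mult_left_mono N)
    moreover have "\<bar>S r n v - (\<Sum>k = 1..M. real k ^ (r - 1) * N k n v)\<bar> \<le> S (r + 1) n v / real M"
      unfolding S_def N_def using M \<open>M \<le> n\<close> r by (intro susceptibility_truncation) auto
    moreover have "S (r + 1) n v / real M \<le> (s (r + 1) t + \<delta>) / real M"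
      using S by (intro divide_right_mono) auto
    moreover have "\<delta> + \<delta> / real M + (\<Sum>k = 1..M. real k ^ (r - 1) * \<delta>) = e"
    proof -
      have "\<delta> * A = e"
        using \<open>0 < A\<close> by (simp add: \<delta>_def)
      then show ?thesis
        by (simp add: A_def distrib_left sum_distrib_left mult.commute)
    qed
    ultimately show "\<bar>s r t - (\<Sum>k = 1..M. ?f k)\<bar> \<le> s (r + 1) t / real M + e"
      using S(1) unfolding abs_le_iff add_divide_distrib by linarith
  qed
  have "(\<lambda>M. (\<Sum>k = 1..M. ?f k) - s r t) \<longlonglongrightarrow> 0"
  proof (rule Lim_null_comparison)
    show "\<forall>\<^sub>F M in sequentially. norm ((\<Sum>k = 1..M. ?f k) - s r t) \<le> s (r + 1) t / real M"
      using eventually_gt_at_top[of 0] by eventually_elim (use bound in \<open>simp add: abs_minus_commute\<close>)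
    show "(\<lambda>M. s (r + 1) t / real M) \<longlonglongrightarrow> 0"
      by real_asymp
  qed
  then have "(\<lambda>M. \<Sum>k = 1..M. ?f k) \<longlonglongrightarrow> s r t"
    by (simp add: LIM_zero_iff)
  \<comment> \<open>The value \<open>\<rho> 0 t\<close> is unconstrained, but 0^(r-1) = 0 as r \<ge>
    2.\<close>
  moreover have "(\<Sum>k = 1..M. ?f k) = (\<Sum>k\<le>M. ?f k)" for M
    using r by (intro sum.mono_neutral_left) (auto simp: not_le)
  ultimately show ?thesis
    by (simp add: sums_def_le)
qed

section \<open>The period\<close>

text \<open>
  For the least positive difference \<open>g\<close> of two elements of the semigroup, say \<open>y\<close> and \<open>y + g\<close>,
  the combinations of \<open>y\<close> and \<open>y + g\<close> already cover all large multiples of \<open>g\<close>.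
\<close>

lemma nat_semigroup_eventually_multiples:
  fixes A :: "nat set"
  assumes add: "\<And>x y. x \<in> A \<Longrightarrow> y \<in> A \<Longrightarrow> x + y \<in> A" and "x0 \<in> A" "0 < x0"
  shows "\<exists>g>0. (\<forall>x\<in>A. g dvd x) \<and> (\<forall>\<^sub>F k in sequentially. g dvd k \<longrightarrow> k \<in> A)"
proof -
  have mult: "Suc m * x \<in> A" if "x \<in> A" for m x
    by (induction m) (use that add in auto)
  define D where "D = (\<lambda>d. 0 < d \<and> (\<exists>y\<in>A. y + d \<in> A))"
  have "D x0"
    unfolding D_def using assms by blast
  define g where "g = (LEAST d. D d)"
  have "D g"
    unfolding g_def using \<open>D x0\<close> by (rule LeastI)
  then obtain y where g: "0 < g" and y: "y \<in> A" "y + g \<in> A"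
    unfolding D_def by blast
  have dvd: "g dvd x" if "x \<in> A" for x
  proof (rule ccontr)
    assume "\<not> g dvd x"
    then have "0 < x mod g"
      by (simp add: dvd_eq_mod_eq_0)
    define q where "q = x div g"
    \<comment> \<open>Only positive coefficients occur, because 0 need not lie in \<open>A\<close>.
      The two elements differ by x - q g = x mod g, against the minimality of g.\<close>
    have "y + Suc q * (y + g) \<in> A" and "(y + g) + x + Suc q * y \<in> A"
      by (intro add mult y that)+
    moreover have "(y + g) + x + Suc q * y = y + Suc q * (y + g) + x mod g"
      using div_mult_mod_eq[of x g] by (simp add: q_def algebra_simps)
    ultimately have "D (x mod g)"
      using \<open>0 < x mod g\<close> unfolding D_def by metis
    then have "g \<le> x mod g"
      unfolding g_def by (rule Least_le)
    then show False
      using mod_less_divisor[OF g, of x] by simp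
  qed
  obtain q where q: "y = g * q"
    using dvd[OF y(1)] by (elim dvdE)
  \<comment> \<open>For q > 0 write k = g m and m = u q + v with v < q. From q^2 \<le> m comes v <
    u, so k = (u - v) y + v (y + g) with a positive first coefficient. The summand 1 in the
    threshold makes m positive when q = 0.\<close>
  have "k \<in> A" if k: "g * (q * q + q + 1) \<le> k" "g dvd k" for k
  proof -
    obtain m where m: "k = g * m"
      using k(2) by (elim dvdE)
    have qm: "q * q + q + 1 \<le> m"
      using k(1) g unfolding m by (subst (asm) mult_le_cancel1) auto
    show ?thesis
    proof (cases "q = 0")
      case True
      have "y + g \<in> A" using y by simp
      with True have "g \<in> A" by (simp add: q)
      then show ?thesis
        using mult[of g "m - 1"] qm m by (simp add: mult.commute)
    next
      case False
      define u v where "u = m div q" and "v = m mod q"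
      have v: "v < q" using False by (simp add: v_def)
      have "q \<le> u"
        unfolding u_def using False qm by (subst less_eq_div_iff_mult_less_eq) auto
      define w where "w = u - v - 1"
      have uw: "u = Suc w + v"
        using v \<open>q \<le> u\<close> by (simp add: w_def)
      have "m = u * q + v"
        by (simp add: u_def v_def)
      then have k': "k = Suc w * y + v * (y + g)"
        by (simp add: m q uw algebra_simps)
      show ?thesis
      proof (cases v)
        case 0
        then show ?thesis using k' mult y by simp
      next
        case (Suc v')
        then show ?thesis using k' mult add y by metis
      qed
    qed
  qed
  then have "\<forall>\<^sub>F k in sequentially. g dvd k \<longrightarrow> k \<in> A"
    unfolding eventually_sequentially by blast
  with g dvd show ?thesis by blast
qed

section \<open>Additive structure of the attainable sizes\<close>

lemma attainable_sizes_pos: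
  assumes "bounded_size_rule l K R" "k \<in> attainable_sizes l K R"
  shows "0 < k"
  using assms(2)
proof induction
  case (merge c)
  have "selected_pair l K R c \<subseteq> {1..l}" "card (selected_pair l K R c) = 2"
    using selected_pair_in[OF assms(1)] merge by blast+
  moreover from this have "finite (selected_pair l K R c)" "selected_pair l K R c \<noteq> {}"
    by (auto intro: card_ge_0_finite)
  ultimately show ?case
    using merge by (intro sum_pos) blast+
qed simp

text \<open>The rule sees truncated sizes only: the pair it picks for the constant tuple x is picked
  again after some entries become y, provided both truncate to K + 1. The pair is therefore known
  before x and y are placed on it.\<close>

lemma attainable_sizes_add:
  assumes R: "bounded_size_rule l K R" and "x \<in> attainable_sizes l K R" "y \<in> attainable_sizes l K R"
    and big: "x = y \<or> (K < x \<and> K < y)"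
  shows "x + y \<in> attainable_sizes l K R"
proof -
  define J where "J = selected_pair l K R (\<lambda>_. x)"
  have "0 < x"
    using attainable_sizes_pos assms by blast
  then have "J \<subseteq> {1..l}" "card J = 2"
    unfolding J_def using selected_pair_in[OF R, of "\<lambda>_. x"] by blast+
  then obtain i j where J: "J = {i, j}" "i \<noteq> j"
    by (auto simp: card_2_iff)
  define c where "c = (\<lambda>k. if k = i then x else y)"
  have "selected_pair l K R c = J"
    unfolding J_def selected_pair_def using big
    by (intro arg_cong[of _ _ R]) (auto simp: c_def restrict_def)
  moreover have "(\<Sum>k\<in>selected_pair l K R c. c k) \<in> attainable_sizes l K R"
    by (rule attainable_sizes.merge) (use assms in \<open>auto simp: c_def\<close>)
  ultimately show ?thesis
    using J by (simp add: c_def)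
qed

lemma period_characterization:
  assumes R: "bounded_size_rule l K R"
  shows "0 < period l K R"
    and "\<forall>\<^sub>F k in sequentially. k \<in> attainable_sizes l K R \<longleftrightarrow> period l K R dvd k"
proof -
  let ?S = "attainable_sizes l K R"
  let ?P = "\<lambda>p. 0 < p \<and> (\<forall>\<^sub>F k in sequentially. k \<in> ?S \<longleftrightarrow> p dvd k)"
  \<comment> \<open>Beyond K the attainable sizes form a semigroup. Doubling is possible at every
    size, so a power of 2 supplies an element.\<close>
  define A where "A = {k \<in> ?S. K < k}"
  have pow: "2 ^ m \<in> ?S" for m
  proof (induction m)
    case (Suc m)
    show ?case
      using attainable_sizes_add[OF R Suc Suc] by (simp add: mult_2)
  qed (use attainable_sizes.one in auto)
  have "\<exists>g>0. (\<forall>x\<in>A. g dvd x) \<and> (\<forall>\<^sub>F k in sequentially. g dvd k \<longrightarrow> k \<in> A)"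
  proof (rule nat_semigroup_eventually_multiples)
    show "x + y \<in> A" if "x \<in> A" "y \<in> A" for x y
      using that attainable_sizes_add[OF R] by (auto simp: A_def)
    show "2 ^ K \<in> A"
      using pow by (auto simp: A_def)
  qed simp
  then obtain g where g: "0 < g" "\<forall>x\<in>A. g dvd x" "\<forall>\<^sub>F k in sequentially. g dvd k \<longrightarrow> k \<in> A"
    by blast
  have "\<forall>\<^sub>F k in sequentially. k \<in> ?S \<longleftrightarrow> g dvd k"
    using g(3) eventually_gt_at_top[of K] by eventually_elim (use g(2) in \<open>auto simp: A_def\<close>)
  with g(1) have "?P g" by simp
  have dvd: "p dvd q" if "?P p" "?P q" for p q
  proof -
    have "\<forall>\<^sub>F k in sequentially. p dvd k \<longleftrightarrow> q dvd k"
      using that[THEN conjunct2] by eventually_elim simp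
    then obtain N where N: "\<And>k. N \<le> k \<Longrightarrow> p dvd k \<longleftrightarrow> q dvd k"
      by (auto simp: eventually_sequentially)
    \<comment> \<open>Both q N and q N + q are at least N, so p divides them and hence their
      difference q.\<close>
    have "N \<le> q * N"
      using that by auto
    moreover from this have "N \<le> q * N + q"
      by linarith
    ultimately have "p dvd q * N" "p dvd q * N + q"
      using N by auto
    then show ?thesis
      by (simp add: dvd_add_right_iff)
  qed
  have "?P (period l K R)"
    unfolding period_def
    by (rule theI[of ?P g]) (use \<open>?P g\<close> dvd dvd_antisym in blast)+
  then show "0 < period l K R" "\<forall>\<^sub>F k in sequentially. k \<in> ?S \<longleftrightarrow> period l K R dvd k"
    by auto
qed

text \<open>Below \<open>k0\<close> the discrepancy is at most 1 \<le> k0/k. In this form the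
  finitely many exceptional sizes merge with the factors 1 + O(1/k) into a single weight.\<close>

lemma period_indicator_bound:
  assumes "bounded_size_rule l K R"
  shows "\<exists>k0. \<forall>k\<ge>1. \<bar>indicator (attainable_sizes l K R) k - of_bool (period l K R dvd k)\<bar> \<le> real k0 / real k"
proof -
  obtain k0 where k0: "\<And>k. k0 \<le> k \<Longrightarrow> k \<in> attainable_sizes l K R \<longleftrightarrow> period l K R dvd k"
    using period_characterization(2)[OF assms] by (auto simp: eventually_sequentially)
  have "\<bar>indicator (attainable_sizes l K R) k - of_bool (period l K R dvd k)\<bar> \<le> real k0 / real k" if "1 \<le> k" for k
  proof (cases "k0 \<le> k")
    case True
    then show ?thesis using k0 by (auto simp: indicator_def)
  next
    case False
    then have "1 \<le> real k0 / real k"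
      using that by (simp add: le_divide_eq)
    then show ?thesis by (auto simp: indicator_def)
  qed
  then show ?thesis by blast
qed

section \<open>Riemann sums of the Gamma integrand\<close>

text \<open>The maximum lies at y = b, where ln z \<le> z - 1 with z = y / b is an equality; the
  division is why b = 0 is treated apart.\<close>

lemma powr_times_exp_minus_bounded:
  fixes b :: real
  assumes "0 \<le> b"
  shows "\<exists>C\<ge>0. \<forall>y>0. y powr b * exp (- y) \<le> C"
proof (cases "b = 0")
  case True
  then show ?thesis by (intro exI[of _ 1]) auto
next
  case False
  have "y powr b * exp (- y) \<le> b powr b * exp (- b)" if "0 < y" for y
  proof -
    have "ln (y / b) \<le> y / b - 1"
      using that assms False by (intro ln_le_minus_one) auto
    then have "b * ln (y / b) \<le> y - b"
      using assms False by (simp add: field_simps)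
    then have "b * ln y - y \<le> b * ln b - b"
      using that assms False by (simp add: ln_div algebra_simps)
    then have "exp (b * ln y - y) \<le> exp (b * ln b - b)"
      by simp
    then show ?thesis
      using that assms False by (simp add: powr_def exp_add[symmetric])
  qed
  then show ?thesis by (intro exI[of _ "b powr b * exp (- b)"]) auto
qed

lemma summable_powr_minus_three_halves: "summable (\<lambda>k. real k powr (- 3 / 2))"
  by (simp add: summable_real_powr_iff)

lemma has_integral_Ici_tendsto:
  fixes f :: "real \<Rightarrow> real"
  assumes f: "(f has_integral I) {0..}" and nonneg: "\<And>u. 0 \<le> u \<Longrightarrow> 0 \<le> f u"
    and int: "\<And>T. f integrable_on {0..T}" and X: "filterlim X at_top sequentially" "mono X"
  shows "(\<lambda>n. integral {0..X n} f) \<longlonglongrightarrow> I"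
proof -
  let ?f = "\<lambda>n u. if u \<in> {0..X n} then f u else 0"
  have eq: "integral {0..} (?f n) = integral {0..X n} f" for n
    unfolding integral_restrict_Int by (rule arg_cong2[of _ _ _ _ integral]) auto
  have int': "?f n integrable_on {0..}" for n
    using int[of "X n"] integrable_restrict_Int[of "{0..X n}" f "{0..}"] 
    by (metis Icc_subset_Ici_iff Int_absorb2 inf_commute order_refl)
  have "f integrable_on {0..} \<and> (\<lambda>n. integral {0..} (?f n)) \<longlonglongrightarrow> integral {0..} f"
  proof (rule monotone_convergence_increasing)
    show "?f n u \<le> ?f (Suc n) u" if "u \<in> {0..}" for n u
      using that nonneg monoD[OF X(2), of n "Suc n"] by auto
    show "(\<lambda>n. ?f n u) \<longlonglongrightarrow> f u" if "u \<in> {0..}" for u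
    proof (rule tendsto_eventually)
      have "\<forall>\<^sub>F n in sequentially. u \<le> X n"
        using X(1) by (simp add: filterlim_at_top)
      then show "\<forall>\<^sub>F n in sequentially. ?f n u = f u"
        by eventually_elim (use that in auto)
    qed
    show "bounded (range (\<lambda>n. integral {0..} (?f n)))"
    proof (rule boundedI)
      fix z assume "z \<in> range (\<lambda>n. integral {0..} (?f n))"
      then obtain n where z: "z = integral {0..} (?f n)" by blast
      have "0 \<le> integral {0..} (?f n)"
        using nonneg by (intro integral_nonneg int') auto
      moreover have "integral {0..} (?f n) \<le> integral {0..} f"
        using nonneg f by (intro integral_le int') auto
      ultimately show "norm z \<le> integral {0..} f"
        by (simp add: z)
    qed
  qed (rule int')
  then show ?thesis
    unfolding eq using integral_unique[OF f] by simp
qed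

text \<open>For a = r - 3/2 the assumption reads r \<ge> 2. The extreme case a = 1/2 has a
  singularity u^(-1/2) at 0; larger a only improve the behaviour there.\<close>

locale gamma_integrand =
  fixes a :: real
  assumes a: "1 / 2 \<le> a"
begin

definition g :: "real \<Rightarrow> real" where
  "g u = u powr (a - 1) * exp (- u)"

lemma g_nonneg: "0 \<le> g u"
  by (simp add: g_def)

text \<open>\<open>0 powr z = 0\<close> for every z, even where u^(a-1) blows up, so index 0 drops
  out of all sums below.\<close>

lemma g_0: "g 0 = 0"
  by (simp add: g_def)

text \<open>The product u^(a-1+b) e^(-u) is bounded once its exponent is nonnegative. The case b =
  1/2 serves near 0, b = 3/2 gives summability.\<close>

lemma g_bound:
  assumes "- a \<le> b - 1"
  shows "\<exists>C\<ge>0. \<forall>u>0. g u \<le> C * u powr (- b)"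
proof -
  obtain C where C: "0 \<le> C" "\<And>y. 0 < y \<Longrightarrow> y powr (a - 1 + b) * exp (- y) \<le> C"
    using powr_times_exp_minus_bounded[of "a - 1 + b"] assms by auto
  have "g u \<le> C * u powr (- b)" if "0 < u" for u
  proof -
    have "u powr (a - 1 + b) * exp (- u) * u powr (- b) \<le> C * u powr (- b)"
      using that C by (intro mult_right_mono) auto
    moreover have "g u = u powr (a - 1 + b) * exp (- u) * u powr (- b)"
      using that by (simp add: g_def powr_add[symmetric])
    ultimately show ?thesis by simp
  qed
  with C(1) show ?thesis by blast
qed

lemma g_deriv:
  assumes "0 < u"
  shows "(g has_real_derivative ((a - 1) * u powr (a - 2) - u powr (a - 1)) * exp (- u)) (at u)"
  unfolding g_def using assms
  by (auto intro!: derivative_eq_intros simp: algebra_simps)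

text \<open>Since g' = (a - 1) g/u - g, the first term calls for the bound with exponent -1/2 and
  the second for the one with -3/2.\<close>

lemma g_deriv_bound:
  "\<exists>D\<ge>0. \<forall>u>0. \<bar>((a - 1) * u powr (a - 2) - u powr (a - 1)) * exp (- u)\<bar> \<le> D * u powr (- 3 / 2)"
proof -
  obtain C where C: "0 \<le> C" "\<And>u. 0 < u \<Longrightarrow> g u \<le> C * u powr (- (1 / 2))"
    using g_bound[of "1 / 2"] a by auto
  obtain C' where C': "0 \<le> C'" "\<And>u. 0 < u \<Longrightarrow> g u \<le> C' * u powr (- (3 / 2))"
    using g_bound[of "3 / 2"] a by auto
  have "\<bar>((a - 1) * u powr (a - 2) - u powr (a - 1)) * exp (- u)\<bar> \<le> (\<bar>a - 1\<bar> * C + C') * u powr (- 3 / 2)"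
    if "0 < u" for u
  proof -
    have eq: "u powr (a - 2) = u powr (a - 1) / u" "u powr (- (3 / 2)) = u powr (- (1 / 2)) / u"
      using that powr_diff[of u "a - 1" 1] powr_diff[of u "- (1 / 2)" 1] by auto
    have "((a - 1) * u powr (a - 2) - u powr (a - 1)) * exp (- u) = (a - 1) * (g u / u) - g u"
      by (simp add: g_def eq algebra_simps)
    also have "\<bar>\<dots>\<bar> \<le> \<bar>a - 1\<bar> * (g u / u) + g u"
      using that g_nonneg[of u] abs_triangle_ineq4[of "(a - 1) * (g u / u)" "g u"]
      by (simp add: abs_mult)
    also have "\<dots> \<le> \<bar>a - 1\<bar> * (C * u powr (- (1 / 2)) / u) + C' * u powr (- (3 / 2))"
      using that C C' by (intro add_mono mult_left_mono divide_right_mono) auto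
    also have "\<dots> = (\<bar>a - 1\<bar> * C + C') * u powr (- 3 / 2)"
      by (simp add: eq add_divide_distrib algebra_simps)
    finally show ?thesis .
  qed
  then show ?thesis
    using C(1) C'(1) by (intro exI[of _ "\<bar>a - 1\<bar> * C + C'"]) auto
qed

lemma g_has_integral: "(g has_integral Gamma a) {0..}"
proof -
  have "g = (\<lambda>t. t powr (a - 1) / exp t)"
    by (rule ext) (simp add: g_def exp_minus divide_inverse)
  then show ?thesis
    using Gamma_integral_real[of a] a by simp
qed

lemma g_integrable: "g integrable_on {s..t}" if "0 \<le> s"
proof -
  have "g absolutely_integrable_on {0..}"
    using g_has_integral g_nonneg by (intro nonnegative_absolutely_integrable_1) (auto simp: integrable_on_def)
  then have "g absolutely_integrable_on {s..t}"
    by (rule absolutely_integrable_on_subinterval) (use that in auto)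
  then show ?thesis
    by (rule set_lebesgue_integral_eq_integral(1))
qed

text \<open>The value of u^(-3/2) at the left endpoint dominates the whole cell, because this power
  decreases. At s = 0 the control is lost.\<close>

lemma integral_g_step:
  assumes D: "\<And>u. 0 < u \<Longrightarrow> \<bar>((a - 1) * u powr (a - 2) - u powr (a - 1)) * exp (- u)\<bar> \<le> D * u powr (- 3 / 2)"
    and "0 \<le> D" "0 < s" "0 < x"
  shows "\<bar>integral {s..s + x} g - x * g s\<bar> \<le> D * s powr (- 3 / 2) * x\<^sup>2"
proof -
  have lip: "\<bar>g u - g s\<bar> \<le> D * s powr (- 3 / 2) * x" if u: "u \<in> {s..s + x}" for u
  proof -
    have "norm (g u - g s) \<le> (D * s powr (- 3 / 2)) * norm (u - s)"
    proof (rule field_differentiable_bound[of "{s..u}"])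
      show "(g has_field_derivative ((a - 1) * v powr (a - 2) - v powr (a - 1)) * exp (- v)) (at v within {s..u})"
        if "v \<in> {s..u}" for v
        by (rule has_field_derivative_at_within[OF g_deriv]) (use that \<open>0 < s\<close> in simp)
      show "norm (((a - 1) * v powr (a - 2) - v powr (a - 1)) * exp (- v)) \<le> D * s powr (- 3 / 2)"
        if "v \<in> {s..u}" for v
      proof -
        have "v powr (- 3 / 2) \<le> s powr (- 3 / 2)"
          using that \<open>0 < s\<close> by (intro powr_mono2') auto
        then have le: "D * v powr (- 3 / 2) \<le> D * s powr (- 3 / 2)"
          using \<open>0 \<le> D\<close> by (rule mult_left_mono)
        have "0 < v"
          using that \<open>0 < s\<close> by simp
        from order_trans[OF D[OF this] le] show ?thesis
          unfolding real_norm_def .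
      qed
    qed (use u in auto)
    also have "\<dots> \<le> (D * s powr (- 3 / 2)) * x"
      using u \<open>0 \<le> D\<close> by (intro mult_left_mono) auto
    finally show ?thesis by simp
  qed
  have "((\<lambda>u. g u - g s) has_integral (integral {s..s + x} g - x * g s)) {s..s + x}"
    using has_integral_diff[OF integrable_integral[OF g_integrable[of s "s + x"]] has_integral_const_real[of "g s" s "s + x"]]
      \<open>0 < s\<close> \<open>0 < x\<close> by simp
  then have "norm (integral {s..s + x} g - x * g s) \<le> D * s powr (- 3 / 2) * x * measure lborel {s..s + x}"
    using lip \<open>0 \<le> D\<close> \<open>0 < x\<close> by (intro has_integral_bound_real[where S = "{}"]) auto
  then show ?thesis
    using \<open>0 < x\<close> by (simp add: power2_eq_square mult.assoc)
qed

text \<open>Covers the cell at 0, where no derivative bound is available: its Riemann term vanishes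
  and its integral alone is within the allowed error.\<close>

lemma integral_g_initial: "\<exists>C\<ge>0. \<forall>x>0. \<bar>integral {0..x} g\<bar> \<le> C * sqrt x"
proof -
  obtain C where C: "0 \<le> C" "\<And>u. 0 < u \<Longrightarrow> g u \<le> C * u powr (- (1 / 2))"
    using g_bound[of "1 / 2"] a by auto
  have "\<bar>integral {0..x} g\<bar> \<le> 2 * C * sqrt x" if "0 < x" for x
  proof -
    have "((\<lambda>u. C * u powr (- (1 / 2))) has_integral C * (x powr (- (1 / 2) + 1) / (- (1 / 2) + 1))) {0..x}"
      using that by (intro has_integral_mult_right has_integral_powr_from_0) auto
    then have 1: "((\<lambda>u. C * u powr (- (1 / 2))) has_integral 2 * C * sqrt x) {0..x}"
      using that by (simp add: powr_half_sqrt mult_ac)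
    have "g u \<le> C * u powr (- (1 / 2))" if "u \<in> {0..x}" for u
      using that C(2)[of u] by (cases "u = 0") (auto simp: g_def)
    then have "integral {0..x} g \<le> 2 * C * sqrt x"
      by (intro has_integral_le[OF integrable_integral[OF g_integrable] 1]) auto
    moreover have "0 \<le> integral {0..x} g"
      by (intro integral_nonneg g_integrable) (auto simp: g_nonneg)
    ultimately show ?thesis by simp
  qed
  then show ?thesis using C(1) by (intro exI[of _ "2 * C"]) auto
qed

lemma summable_g:
  assumes "0 < x"
  shows "summable (\<lambda>j. g (x * real j))"
proof -
  obtain C where C: "0 \<le> C" "\<And>u. 0 < u \<Longrightarrow> g u \<le> C * u powr (- (3 / 2))"
    using g_bound[of "3 / 2"] a by auto
  have "g (x * real j) \<le> C * x powr (- 3 / 2) * real j powr (- 3 / 2)" for j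
    using C(2)[of "x * real j"] assms
    by (cases "j = 0") (auto simp: g_def powr_mult mult.assoc)
  then show ?thesis
    by (intro summable_comparison_test'[OF summable_mult[OF summable_powr_minus_three_halves]])
       (use g_nonneg in auto)
qed

lemma riemann_sum_g: "\<exists>D\<ge>0. \<forall>x>0. \<bar>x * (\<Sum>j. g (x * real j)) - Gamma a\<bar> \<le> D * sqrt x"
proof -
  obtain D where D: "0 \<le> D"
    "\<And>u. 0 < u \<Longrightarrow> \<bar>((a - 1) * u powr (a - 2) - u powr (a - 1)) * exp (- u)\<bar> \<le> D * u powr (- 3 / 2)"
    using g_deriv_bound by blast
  obtain C where C: "0 \<le> C" "\<And>x. 0 < x \<Longrightarrow> \<bar>integral {0..x} g\<bar> \<le> C * sqrt x"
    using integral_g_initial by blast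
  define Z where "Z = (\<Sum>k. real k powr (- 3 / 2))"
  have "0 \<le> Z"
    unfolding Z_def by (intro suminf_nonneg summable_powr_minus_three_halves) auto
  have "\<bar>x * (\<Sum>j. g (x * real j)) - Gamma a\<bar> \<le> (D * Z + C) * sqrt x" if x: "0 < x" for x
  proof -
    have step: "\<bar>integral {x * real j..x * real (Suc j)} g - x * g (x * real j)\<bar> \<le>
        D * sqrt x * real j powr (- 3 / 2)" if "0 < j" for j
    proof -
      have "\<bar>integral {x * real j..x * real j + x} g - x * g (x * real j)\<bar> \<le>
          D * (x * real j) powr (- 3 / 2) * x\<^sup>2"
        using that x D by (intro integral_g_step) auto
      moreover have "(x * real j) powr (- 3 / 2) * x\<^sup>2 = sqrt x * real j powr (- 3 / 2)"
      proof -
        have "x powr (- 3 / 2) * x\<^sup>2 = sqrt x"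
          using x powr_add[of x "- 3 / 2" 2] by (simp add: powr_half_sqrt)
        then show ?thesis using x by (simp add: powr_mult mult_ac)
      qed
      ultimately show ?thesis by (simp add: algebra_simps)
    qed
    \<comment> \<open>The cell at 0 accounts for \<open>C * sqrt x\<close>, each later cell for its
      \<open>step\<close> bound.\<close>
    have partial: "\<bar>(\<Sum>j<N. x * g (x * real j)) - integral {0..x * real N} g\<bar> \<le>
        D * sqrt x * (\<Sum>j<N. real j powr (- 3 / 2)) + C * sqrt x" for N
    proof (induction N)
      case 0
      show ?case using C x by simp
    next
      case (Suc N)
      show ?case
      proof (cases "N = 0")
        case True
        then show ?thesis using C(2)[OF x] g_0 by simp
      next
        case False
        have "integral {0..x * real N} g + integral {x * real N..x * real (Suc N)} g = integral {0..x * real (Suc N)} g"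
          using x by (intro Henstock_Kurzweil_Integration.integral_combine g_integrable) auto
        then show ?thesis
          using step[of N] Suc False by (simp add: algebra_simps)
      qed
    qed
    have "(\<lambda>N. \<bar>(\<Sum>j<N. x * g (x * real j)) - integral {0..x * real N} g\<bar>) \<longlonglongrightarrow>
        \<bar>x * (\<Sum>j. g (x * real j)) - Gamma a\<bar>"
    proof (intro tendsto_intros)
      show "(\<lambda>N. \<Sum>j<N. x * g (x * real j)) \<longlonglongrightarrow> x * (\<Sum>j. g (x * real j))"
        using sums_mult[OF summable_sums[OF summable_g[OF x]], of x] by (simp add: sums_def)
      show "(\<lambda>N. integral {0..x * real N} g) \<longlonglongrightarrow> Gamma a"
      proof (rule has_integral_Ici_tendsto[OF g_has_integral g_nonneg g_integrable])
        show "filterlim (\<lambda>N. x * real N) at_top sequentially"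
          using x by real_asymp
        show "mono (\<lambda>N. x * real N)"
          using x by (intro monoI) auto
      qed auto
    qed
    moreover have "\<bar>(\<Sum>j<N. x * g (x * real j)) - integral {0..x * real N} g\<bar> \<le> (D * Z + C) * sqrt x" for N
    proof -
      have "(\<Sum>j<N. real j powr (- 3 / 2)) \<le> Z"
        unfolding Z_def by (intro sum_le_suminf summable_powr_minus_three_halves) auto
      then have "D * sqrt x * (\<Sum>j<N. real j powr (- 3 / 2)) \<le> D * sqrt x * Z"
        using D x by (intro mult_left_mono) auto
      then show ?thesis
        using partial[of N] by (simp add: algebra_simps)
    qed
    ultimately show ?thesis
      by (intro LIMSEQ_le_const2) auto
  qed
  then show ?thesis
    using D(1) C(1) \<open>0 \<le> Z\<close> by (intro exI[of _ "D * Z + C"]) auto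
qed

text \<open>The weights will vary with t, and so with x; hence \<open>D\<close> is chosen before
  both. The multiples of p give a Riemann sum of mesh p x, whence the factor 1/p.\<close>

lemma riemann_sum_g_multiples:
  assumes p: "0 < p"
  shows "\<exists>D\<ge>0. \<forall>x>0. \<forall>w. (\<forall>k\<ge>1. \<bar>w k - of_bool (p dvd k)\<bar> \<le> C / real k) \<longrightarrow>
    summable (\<lambda>k. w k * g (x * real k)) \<and>
    \<bar>x * (\<Sum>k. w k * g (x * real k)) - Gamma a / real p\<bar> \<le> D * sqrt x"
proof -
  obtain D where D: "0 \<le> D" "\<And>x. 0 < x \<Longrightarrow> \<bar>x * (\<Sum>j. g (x * real j)) - Gamma a\<bar> \<le> D * sqrt x"
    using riemann_sum_g by blast
  obtain B where B: "0 \<le> B" "\<And>u. 0 < u \<Longrightarrow> g u \<le> B * u powr (- (1 / 2))"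
    using g_bound[of "1 / 2"] a by auto
  define Z where "Z = (\<Sum>k. real k powr (- 3 / 2))"
  have "0 \<le> Z"
    unfolding Z_def by (intro suminf_nonneg summable_powr_minus_three_halves) auto
  \<comment> \<open>The first summand is the error of \<open>riemann_sum_g\<close> at p x, divided
    by p; the second comes from the deviation of \<open>w\<close> from the indicator. The sign of
    \<open>C\<close> is not prescribed, hence its absolute value.\<close>
  define D' where "D' = D * sqrt (real p) / real p + \<bar>C\<bar> * B * Z"
  have "summable (\<lambda>k. w k * g (x * real k)) \<and>
      \<bar>x * (\<Sum>k. w k * g (x * real k)) - Gamma a / real p\<bar> \<le> D' * sqrt x"
    if x: "0 < x" and w: "\<And>k. 1 \<le> k \<Longrightarrow> \<bar>w k - of_bool (p dvd k)\<bar> \<le> C / real k" for x w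
  proof -
    let ?m = "\<lambda>k. of_bool (p dvd k) * g (x * real k)"
    let ?e = "\<lambda>k. (w k - of_bool (p dvd k)) * g (x * real k)"
    have px: "0 < real p * x"
      using p x by simp
    have m_sums: "?m sums (\<Sum>j. g (real p * x * real j))"
    proof (subst sums_mono_reindex[of "\<lambda>j. p * j", symmetric])
      show "strict_mono (\<lambda>j. p * j)"
        using p by (intro strict_monoI) simp
      show "(\<lambda>j. ?m (p * j)) sums (\<Sum>j. g (real p * x * real j))"
        using summable_sums[OF summable_g[OF px]] by (simp add: mult_ac)
    qed auto
    have e_le: "norm (?e k) \<le> \<bar>C\<bar> * B * x powr (- 1 / 2) * real k powr (- 3 / 2)" for k
    proof (cases "k = 0")
      case True
      then show ?thesis by (simp add: g_0)
    next
      case False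
      have "\<bar>w k - of_bool (p dvd k)\<bar> \<le> \<bar>C\<bar> / real k"
        using w[of k] False by (intro order_trans[OF w] divide_right_mono) auto
      moreover have "g (x * real k) \<le> B * (x * real k) powr (- (1 / 2))"
        using B x False by simp
      ultimately have "norm (?e k) \<le> \<bar>C\<bar> / real k * (B * (x * real k) powr (- (1 / 2)))"
        unfolding real_norm_def abs_mult using g_nonneg[of "x * real k"] by (intro mult_mono) auto
      also have "\<dots> = \<bar>C\<bar> * B * x powr (- 1 / 2) * (real k powr (- (1 / 2)) / real k)"
        using x by (simp add: powr_mult)
      also have "real k powr (- (1 / 2)) / real k = real k powr (- 3 / 2)"
        using False powr_diff[of "real k" "- (1 / 2)" 1] by simp
      finally show ?thesis .
    qed
    have e_summable: "summable ?e"
      by (rule summable_comparison_test'[OF summable_mult[OF summable_powr_minus_three_halves] e_le])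
    have "norm (\<Sum>k. ?e k) \<le> (\<Sum>k. \<bar>C\<bar> * B * x powr (- 1 / 2) * real k powr (- 3 / 2))"
      by (rule norm_suminf_le[OF e_le summable_mult[OF summable_powr_minus_three_halves]])
    also have "\<dots> = \<bar>C\<bar> * B * x powr (- 1 / 2) * Z"
      unfolding Z_def by (rule suminf_mult[OF summable_powr_minus_three_halves])
    finally have "x * norm (\<Sum>k. ?e k) \<le> x * (\<bar>C\<bar> * B * x powr (- 1 / 2) * Z)"
      using x by (intro mult_left_mono) auto
    moreover have "x * x powr (- 1 / 2) = sqrt x"
      using x powr_add[of x 1 "- 1 / 2"] by (simp add: powr_half_sqrt)
    then have "x * (\<bar>C\<bar> * B * x powr (- 1 / 2) * Z) = \<bar>C\<bar> * B * Z * sqrt x"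
      by (metis mult.assoc mult.left_commute mult.commute)
    ultimately have e_bound: "\<bar>x * (\<Sum>k. ?e k)\<bar> \<le> \<bar>C\<bar> * B * Z * sqrt x"
      unfolding abs_mult using x by (simp only: abs_of_pos real_norm_def)
    have "\<bar>x * (\<Sum>j. g (real p * x * real j)) - Gamma a / real p\<bar> =
        \<bar>real p * x * (\<Sum>j. g (real p * x * real j)) - Gamma a\<bar> / real p"
      using p by (subst abs_div_pos) (auto simp: field_simps)
    also have "\<dots> \<le> D * sqrt (real p * x) / real p"
      using D(2)[OF px] by (rule divide_right_mono) simp
    also have "\<dots> = D * sqrt (real p) / real p * sqrt x"
      by (simp add: real_sqrt_mult)
    finally have m_bound: "\<bar>x * (\<Sum>j. g (real p * x * real j)) - Gamma a / real p\<bar> \<le>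
      D * sqrt (real p) / real p * sqrt x" .
    have "(\<lambda>k. ?m k + ?e k) sums ((\<Sum>j. g (real p * x * real j)) + (\<Sum>k. ?e k))"
      by (rule sums_add[OF m_sums summable_sums[OF e_summable]])
    then have "(\<lambda>k. w k * g (x * real k)) sums ((\<Sum>j. g (real p * x * real j)) + (\<Sum>k. ?e k))"
      by (simp add: algebra_simps)
    then have sum: "summable (\<lambda>k. w k * g (x * real k))"
      "x * (\<Sum>k. w k * g (x * real k)) = x * (\<Sum>j. g (real p * x * real j)) + x * (\<Sum>k. ?e k)"
      by (simp_all add: sums_iff distrib_left)
    have "\<bar>x * (\<Sum>k. w k * g (x * real k)) - Gamma a / real p\<bar> \<le>
      D * sqrt (real p) / real p * sqrt x + \<bar>C\<bar> * B * Z * sqrt x"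
      using m_bound e_bound unfolding sum(2) by linarith
    then show ?thesis
      using sum(1) unfolding D'_def distrib_right by blast
  qed
  moreover have "0 \<le> D'"
    unfolding D'_def using D(1) B(1) \<open>0 \<le> Z\<close> by simp
  ultimately show ?thesis by blast
qed

end

section \<open>Analytic functions near the critical time\<close>

lemma real_analytic_on_interiorE:
  assumes "real_analytic_on f S" "c \<in> interior S"
  obtains d :: real and a :: "nat \<Rightarrow> real" where "0 < d"
    "\<And>z. \<bar>z\<bar> < d \<Longrightarrow> (\<lambda>m. a m * z ^ m) sums f (c + z)"
proof -
  obtain e where e: "0 < e" "ball c e \<subseteq> S"
    using assms(2) by (meson mem_interior)
  then have "c \<in> S"
    by auto
  then obtain d a where d: "0 < d" "\<And>y. y \<in> S \<Longrightarrow> \<bar>y - c\<bar> < d \<Longrightarrow> (\<lambda>m. a m * (y - c) ^ m) sums f y"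
    using assms(1) unfolding real_analytic_on_def by blast
  show ?thesis
  proof (rule that[of "min d e" a])
    show "0 < min d e"
      using d e by simp
    show "(\<lambda>m. a m * z ^ m) sums f (c + z)" if "\<bar>z\<bar> < min d e" for z
      using d(2)[of "c + z"] e(2) that by (auto simp: dist_real_def subset_eq)
  qed
qed

text \<open>Yields the series of the derivative on the whole interval rather than its value at c, so
  that it applies a second time, to \<open>deriv f\<close>.\<close>

lemma power_series_deriv_sums:
  fixes f :: "real \<Rightarrow> real"
  assumes f: "\<And>z. \<bar>z\<bar> < d \<Longrightarrow> (\<lambda>m. a m * z ^ m) sums f (c + z)" and z: "\<bar>z\<bar> < d"
  shows "(\<lambda>m. diffs a m * z ^ m) sums deriv f (c + z)"
proof -
  define F where "F = (\<lambda>z. \<Sum>m. a m * z ^ m)"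
  have F: "(\<lambda>m. a m * z ^ m) sums F z" if "norm z < d" for z
    using f[of z] that unfolding F_def by (intro summable_sums) (auto simp: sums_iff)
  have DF: "(F has_real_derivative (\<Sum>m. diffs a m * z ^ m)) (at z)"
    unfolding F_def using f z by (intro termdiffs_strong'[of d]) (auto simp: sums_iff)
  then have DF': "(\<lambda>m. diffs a m * z ^ m) sums (\<Sum>m. diffs a m * z ^ m)"
    using termdiffs_sums_strong[OF F DF] z by simp
  have "((\<lambda>y. F (y - c)) has_real_derivative (\<Sum>m. diffs a m * z ^ m)) (at (c + z))"
    using DF DERIV_shift[of F _ "c + z" "- c"] by simp
  moreover have ev: "\<forall>\<^sub>F y in nhds (c + z). F (y - c) = f y"
  proof -
    have "\<forall>\<^sub>F y in nhds (c + z). y \<in> ball c d"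
      using z by (intro eventually_nhds_in_open) (auto simp: dist_real_def)
    then show ?thesis
    proof eventually_elim
      case (elim y)
      then show ?case
        using f[of "y - c"] by (auto simp: F_def sums_iff dist_real_def abs_minus_commute)
    qed
  qed
  ultimately have "(f has_real_derivative (\<Sum>m. diffs a m * z ^ m)) (at (c + z))"
    using DERIV_cong_ev[OF refl ev refl] by simp
  then show ?thesis
    using DF' by (simp add: DERIV_imp_deriv)
qed

text \<open>The remainder is z^N times a power series, dominated by its absolute series at d/2; that
  one converges because the original series converges at 3d/4.\<close>

lemma power_series_taylor_bound:
  fixes f :: "real \<Rightarrow> real"
  assumes "0 < d" and f: "\<And>z. \<bar>z\<bar> < d \<Longrightarrow> (\<lambda>m. a m * z ^ m) sums f (c + z)"
  shows "\<exists>C\<ge>0. \<forall>z. \<bar>z\<bar> \<le> d / 2 \<longrightarrow> \<bar>f (c + z) - (\<Sum>m<N. a m * z ^ m)\<bar> \<le> C * \<bar>z\<bar> ^ N"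
proof -
  let ?b = "\<lambda>m. \<bar>a (m + N)\<bar> * (d / 2) ^ m"
  have "summable (\<lambda>m. a m * (3 * d / 4) ^ m)"
    using f[of "3 * d / 4"] \<open>0 < d\<close> by (auto simp: sums_iff)
  then have "summable (\<lambda>m. norm (a m * (d / 2) ^ m))"
    by (rule powser_insidea) (use \<open>0 < d\<close> in auto)
  then have "summable (\<lambda>m. norm (a (m + N) * (d / 2) ^ (m + N)))"
    by (subst summable_iff_shift)
  then have "summable (\<lambda>m. norm (a (m + N) * (d / 2) ^ (m + N)) / (d / 2) ^ N)"
    by (rule summable_divide)
  then have b: "summable ?b"
    using \<open>0 < d\<close> by (simp add: abs_mult power_add power_abs)
  have "\<bar>f (c + z) - (\<Sum>m<N. a m * z ^ m)\<bar> \<le> (\<Sum>m. ?b m) * \<bar>z\<bar> ^ N" if z: "\<bar>z\<bar> \<le> d / 2" for z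
  proof -
    have "(\<lambda>m. a (m + N) * z ^ (m + N)) sums (f (c + z) - (\<Sum>m<N. a m * z ^ m))"
      using sums_split_initial_segment[OF f[of z], of N] z \<open>0 < d\<close> by simp
    then have "\<bar>f (c + z) - (\<Sum>m<N. a m * z ^ m)\<bar> = norm (\<Sum>m. a (m + N) * z ^ (m + N))"
      by (simp add: sums_iff)
    also have "\<dots> \<le> (\<Sum>m. ?b m * \<bar>z\<bar> ^ N)"
    proof (rule norm_suminf_le[OF _ summable_mult2[OF b]])
      show "norm (a (m + N) * z ^ (m + N)) \<le> ?b m * \<bar>z\<bar> ^ N" for m
      proof -
        have "\<bar>z\<bar> ^ m \<le> (d / 2) ^ m"
          using z by (intro power_mono) auto
        then have "\<bar>a (m + N)\<bar> * \<bar>z\<bar> ^ m * \<bar>z\<bar> ^ N \<le> \<bar>a (m + N)\<bar> * (d / 2) ^ m * \<bar>z\<bar> ^ N"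
          by (intro mult_right_mono mult_left_mono) auto
        then show ?thesis
          by (simp add: abs_mult power_add power_abs mult.assoc)
      qed
    qed
    also have "\<dots> = (\<Sum>m. ?b m) * \<bar>z\<bar> ^ N"
      using suminf_mult2[OF b] by simp
    finally show ?thesis .
  qed
  moreover have "0 \<le> (\<Sum>m. ?b m)"
    using b \<open>0 < d\<close> by (intro suminf_nonneg) auto
  ultimately show ?thesis by blast
qed

lemma real_analytic_on_first_order:
  assumes "real_analytic_on f S" "c \<in> interior S"
  shows "\<exists>d>0. \<exists>C\<ge>0. \<forall>z. \<bar>z\<bar> \<le> d \<longrightarrow> \<bar>f (c + z) - f c\<bar> \<le> C * \<bar>z\<bar>"
proof -
  obtain d a where d: "0 < d" and a: "\<And>z. \<bar>z\<bar> < d \<Longrightarrow> (\<lambda>m. a m * z ^ m) sums f (c + z)"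
    using real_analytic_on_interiorE[OF assms] by blast
  have "f c = a 0"
    using a[of 0] d powser_sums_zero_iff[of a "f c"] by simp
  then show ?thesis
    using power_series_taylor_bound[OF d a, of 1] d by (intro exI[of _ "d / 2"]) auto
qed

lemma real_analytic_on_second_order:
  assumes "real_analytic_on f S" "c \<in> interior S"
  shows "\<exists>d>0. \<exists>C\<ge>0. \<forall>z. \<bar>z\<bar> \<le> d \<longrightarrow>
    \<bar>f (c + z) - (f c + deriv f c * z + deriv (deriv f) c / 2 * z\<^sup>2)\<bar> \<le> C * \<bar>z\<bar> ^ 3"
proof -
  obtain d a where d: "0 < d" and a: "\<And>z. \<bar>z\<bar> < d \<Longrightarrow> (\<lambda>m. a m * z ^ m) sums f (c + z)"
    using real_analytic_on_interiorE[OF assms] by blast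
  have a': "\<And>z. \<bar>z\<bar> < d \<Longrightarrow> (\<lambda>m. diffs a m * z ^ m) sums deriv f (c + z)"
    by (rule power_series_deriv_sums[OF a])
  have a'': "\<And>z. \<bar>z\<bar> < d \<Longrightarrow> (\<lambda>m. diffs (diffs a) m * z ^ m) sums deriv (deriv f) (c + z)"
    by (rule power_series_deriv_sums[OF a'])
  have "a 0 = f c"
    using a[of 0] d powser_sums_zero_iff[of a "f c"] by simp
  moreover have "diffs a 0 = deriv f c"
    using a'[of 0] d powser_sums_zero_iff[of "diffs a" "deriv f c"] by simp
  moreover have "diffs (diffs a) 0 = deriv (deriv f) c"
    using a''[of 0] d powser_sums_zero_iff[of "diffs (diffs a)" "deriv (deriv f) c"] by simp
  ultimately have "f c = a 0" "deriv f c = a 1" "deriv (deriv f) c = 2 * a 2"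
    by (simp_all add: diffs_def numeral_2_eq_2)
  then have "f c + deriv f c * z + deriv (deriv f) c / 2 * z\<^sup>2 = (\<Sum>m<3. a m * z ^ m)" for z
    by (simp add: numeral_3_eq_3 numeral_2_eq_2)
  then show ?thesis
    using power_series_taylor_bound[OF d a, of 3] d by (intro exI[of _ "d / 2"]) auto
qed

section \<open>Relative errors of powers and products\<close>

lemma powr_near_one:
  fixes b :: real
  shows "\<exists>L\<ge>0. \<forall>w\<in>{1/2..3/2}. \<bar>w powr b - 1\<bar> \<le> L * \<bar>w - 1\<bar>"
proof -
  \<comment> \<open>The direction in which \<open>v powr (b - 1)\<close> is monotone depends on b,
    so the values at both endpoints are added.\<close>
  define L where "L = \<bar>b\<bar> * ((1/2) powr (b - 1) + (3/2) powr (b - 1))"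
  have "norm (w powr b - 1 powr b) \<le> L * norm (w - 1)" if "w \<in> {1/2..3/2}" for w :: real
  proof (rule field_differentiable_bound[of "{1/2..3/2}"])
    show "((\<lambda>w. w powr b) has_field_derivative b * v powr (b - 1)) (at v within {1/2..3/2})"
      if "v \<in> {1/2..3/2}" for v
      using that by (auto intro!: has_field_derivative_at_within has_real_derivative_powr)
    show "norm (b * v powr (b - 1)) \<le> L" if v: "v \<in> {1/2..3/2}" for v
    proof -
      have "v powr (b - 1) \<le> (1/2) powr (b - 1) + (3/2) powr (b - 1)"
      proof (cases "1 \<le> b")
        case True
        then have "v powr (b - 1) \<le> (3/2) powr (b - 1)"
          using v by (intro powr_mono2) auto
        then show ?thesis by (simp add: add_increasing)
      next
        case False
        then have "v powr (b - 1) \<le> (1/2) powr (b - 1)"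
          using v by (intro powr_mono2') auto
        then show ?thesis by (simp add: add_increasing2)
      qed
      then show ?thesis
        unfolding L_def by (simp add: abs_mult mult_left_mono)
    qed
  qed (use that in auto)
  then show ?thesis
    unfolding L_def by (intro exI[of _ "\<bar>b\<bar> * ((1/2) powr (b - 1) + (3/2) powr (b - 1))"]) auto
qed

text \<open>The bound \<open>e0\<close> makes the product of the two errors linear in e
  again.\<close>

lemma mult_near_one:
  fixes u v :: real
  assumes "0 \<le> A" "0 \<le> B" "0 \<le> e" "e \<le> e0" "\<bar>u - 1\<bar> \<le> A * e" "\<bar>v - 1\<bar> \<le> B * e"
  shows "\<bar>u * v - 1\<bar> \<le> (A + B + A * B * e0) * e"
proof -
  have "\<bar>u * v - 1\<bar> = \<bar>(u - 1) * (v - 1) + ((u - 1) + (v - 1))\<bar>"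
    by (simp add: algebra_simps)
  also have "\<dots> \<le> \<bar>u - 1\<bar> * \<bar>v - 1\<bar> + (\<bar>u - 1\<bar> + \<bar>v - 1\<bar>)"
    using abs_triangle_ineq[of "(u - 1) * (v - 1)" "(u - 1) + (v - 1)"] abs_triangle_ineq[of "u - 1" "v - 1"]
    unfolding abs_mult by linarith
  also have "\<dots> \<le> (A * e) * (B * e) + (A * e + B * e)"
    using assms by (intro add_mono mult_mono) auto
  also have "(A * e) * (B * e) \<le> (A * e) * (B * e0)"
    using assms by (intro mult_left_mono) auto
  finally show ?thesis
    by (simp add: algebra_simps)
qed

section \<open>Gamma at half-integers\<close>

lemma double_factorial_add_2:
  assumes "- 1 \<le> x" "odd x"
  shows "double_factorial (x + 2) = (x + 2) * double_factorial x"
proof -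
  let ?n = "\<lceil>real_of_int x / 2\<rceil>"
  have "\<lceil>real_of_int (x + 2) / 2\<rceil> = ?n + 1"
    by (simp add: add_divide_distrib)
  moreover have "(\<Prod>j\<in>{0..<?n + 1}. x + 2 - 2 * j) = (x + 2) * (\<Prod>j\<in>{0..<?n}. x - 2 * j)"
  proof -
    \<comment> \<open>At x = -1 the ceiling of -1/2 is 0, which is the empty product (-1)!! =
      1.\<close>
    have "0 \<le> ?n"
      using assms by linarith
    then have "{0..<?n + 1} = insert 0 {0 + 1..<?n + 1}"
      by auto
    then have "(\<Prod>j\<in>{0..<?n + 1}. x + 2 - 2 * j) = (x + 2) * (\<Prod>j\<in>{0 + 1..<?n + 1}. x + 2 - 2 * j)"
      by (simp only:) (subst prod.insert, auto)
    also have "(\<Prod>j\<in>{0 + 1..<?n + 1}. x + 2 - 2 * j) = (\<Prod>j\<in>{0..<?n}. x - 2 * j)"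
      by (rule prod.reindex_bij_witness[of _ "\<lambda>j. j + 1" "\<lambda>j. j - 1"]) auto
    finally show ?thesis .
  qed
  ultimately show ?thesis
    unfolding double_factorial_def by simp
qed

text \<open>From r to r + 1 both sides gain the factor 2r - 3, twice the argument r - 3/2 of Gamma.
  At r = 2 this is Gamma(1/2) = sqrt(pi), times sqrt 2.\<close>

lemma Gamma_half_integer_double_factorial:
  assumes "2 \<le> r"
  shows "Gamma (real r - 3 / 2) * 2 powr (real r - 3 / 2) =
    real_of_int (double_factorial (2 * int r - 5)) * sqrt (2 * pi)"
  using assms
proof (induction r rule: dec_induct)
  case base
  have "\<lceil>- 1 / 2 :: real\<rceil> = 0"
    by linarith
  then show ?case
    by (simp add: double_factorial_def Gamma_one_half_real powr_half_sqrt real_sqrt_mult)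
next
  case (step r)
  let ?a = "real r - 3 / 2"
  let ?d = "double_factorial (2 * int r - 5)"
  have "Gamma (?a + 1) * 2 powr (?a + 1) = 2 * ?a * (Gamma ?a * 2 powr ?a)"
  proof -
    have G: "Gamma (?a + 1) = ?a * Gamma ?a"
      by (rule Gamma_plus1) (use step in \<open>auto dest: nonpos_Ints_nonpos\<close>)
    have P: "(2::real) powr (?a + 1) = 2 powr ?a * 2"
      unfolding powr_add by simp
    show ?thesis
      unfolding G P by (simp only: mult_ac)
  qed
  also have "\<dots> = real_of_int ((2 * int r - 3) * ?d) * sqrt (2 * pi)"
    unfolding step.IH by (simp add: algebra_simps)
  also have "(2 * int r - 3) * ?d = double_factorial (2 * int (Suc r) - 5)"
    using double_factorial_add_2[of "2 * int r - 5"] step by (simp add: algebra_simps)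
  finally show ?case
    by (simp add: add.commute)
qed

section \<open>Critical scaling\<close>

theorem theorem2p14:
  fixes l K :: nat and R :: rule and tc :: real
    and \<rho> s :: "nat \<Rightarrow> real \<Rightarrow> real" and \<theta> \<psi> :: "real \<Rightarrow> real"
  assumes "bounded_size_rule l K R"
    and "is_critical_time l K R tc"
    and "is_limit_size_density l K R \<rho>"
    and "is_limit_susceptibility l K R tc s"
    and "are_associated_functions l K R tc \<rho> \<theta> \<psi>"
  shows "\<exists>\<epsilon>0>0. \<forall>r\<ge>2.
    susceptibility_constant l K R tc \<theta> \<psi> r > 0 \<and>
    (\<exists>C. \<forall>\<epsilon>\<in>{0<..<\<epsilon>0}. \<exists>\<eta>. \<bar>\<eta>\<bar> \<le> C * \<epsilon> \<and>
       s r (tc - \<epsilon>) = (1 + \<eta>) * susceptibility_constant l K R tc \<theta> \<psi> r *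
         \<epsilon> powi (- 2 * int r + 3))"
proof -
  define p where "p = period l K R"
  have p: "0 < p"
    unfolding p_def using period_characterization(1) assms(1) .
  have tc: "0 < tc"
    using assms(2) by (simp add: is_critical_time_def)
  \<comment> \<open>The leading coefficient of \<psi> at tc, where \<psi> and its first derivative
    vanish.\<close>
  define b where "b = deriv (deriv \<psi>) tc / 2"
  obtain e1 C where e1: "0 < e1" and an: "real_analytic_on \<theta> {tc - e1..tc + e1}" "real_analytic_on \<psi> {tc - e1..tc + e1}"
    and \<rho>: "\<forall>k\<ge>1. \<forall>t\<in>{tc - e1..tc + e1}. \<exists>\<eta>. \<bar>\<eta>\<bar> \<le> C / real k \<and>
      \<rho> k t = (1 + \<eta>) * indicator (attainable_sizes l K R) k *
        real k powr (- 3 / 2) * \<theta> t * exp (- \<psi> t * real k)"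
    using assms(5) unfolding are_associated_functions_def Let_def by blast
  have \<theta>c: "0 < \<theta> tc" and b: "0 < b" and \<psi>c: "\<psi> tc = 0" "deriv \<psi> tc = 0"
    using assms(5) by (auto simp: are_associated_functions_def b_def)
  have int: "tc \<in> interior {tc - e1..tc + e1}"
    using e1 by simp
  obtain d1 C1 where d1: "0 < d1" "0 \<le> C1" and \<theta>: "\<And>z. \<bar>z\<bar> \<le> d1 \<Longrightarrow> \<bar>\<theta> (tc + z) - \<theta> tc\<bar> \<le> C1 * \<bar>z\<bar>"
    using real_analytic_on_first_order[OF an(1) int] by blast
  obtain d2 C2 where d2: "0 < d2" "0 \<le> C2" and \<psi>: "\<And>z. \<bar>z\<bar> \<le> d2 \<Longrightarrow> \<bar>\<psi> (tc + z) - b * z\<^sup>2\<bar> \<le> C2 * \<bar>z\<bar> ^ 3"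
    using real_analytic_on_second_order[OF an(2) int] \<psi>c by (auto simp: b_def)
  obtain k0 where k0: "\<And>k. 1 \<le> k \<Longrightarrow>
      \<bar>indicator (attainable_sizes l K R) k - of_bool (p dvd k)\<bar> \<le> real k0 / real k"
    using period_indicator_bound[OF assms(1)] unfolding p_def by blast
  \<comment> \<open>The last entry ensures C2 e \<le> b/2, so that \<psi>(tc - e) is positive and
    within a factor in [1/2, 3/2] of b e^2; its + 1 guards against C2 = 0. The entry
    \<open>tc\<close> keeps times nonnegative.\<close>
  define e0 where "e0 = Min {e1, tc, d1, d2, b / (2 * C2 + 1)}"
  have e0: "0 < e0" "e0 \<le> e1" "e0 \<le> tc" "e0 \<le> d1" "e0 \<le> d2" "e0 \<le> b / (2 * C2 + 1)"
    unfolding e0_def using e1 tc d1 d2 b by auto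
  have C2e0: "C2 * e0 \<le> b / 2"
  proof -
    have "(2 * C2 + 1) * e0 \<le> b"
      using e0(6) d2 by (simp add: field_simps)
    then show ?thesis using e0(1) by (simp add: algebra_simps)
  qed
  have \<theta>_near: "\<bar>\<theta> (tc - e) / \<theta> tc - 1\<bar> \<le> C1 / \<theta> tc * e" if "e \<in> {0<..<e0}" for e
  proof -
    have "\<bar>\<theta> (tc - e) - \<theta> tc\<bar> / \<theta> tc \<le> C1 * e / \<theta> tc"
      using \<theta>[of "- e"] that e0 \<theta>c by (intro divide_right_mono) auto
    moreover have "\<bar>\<theta> (tc - e) / \<theta> tc - 1\<bar> = \<bar>\<theta> (tc - e) - \<theta> tc\<bar> / \<theta> tc"
      using \<theta>c by (subst abs_div_pos) (auto simp: diff_divide_distrib)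
    ultimately show ?thesis by simp
  qed
  have \<psi>_near: "\<bar>\<psi> (tc - e) / (b * e\<^sup>2) - 1\<bar> \<le> C2 / b * e" if "e \<in> {0<..<e0}" for e
  proof -
    have be: "0 < b * e\<^sup>2"
      using that b by simp
    have "\<bar>\<psi> (tc - e) - b * e\<^sup>2\<bar> / (b * e\<^sup>2) \<le> C2 * e ^ 3 / (b * e\<^sup>2)"
      using \<psi>[of "- e"] that e0 b by (intro divide_right_mono) auto
    moreover have "\<bar>\<psi> (tc - e) / (b * e\<^sup>2) - 1\<bar> = \<bar>\<psi> (tc - e) - b * e\<^sup>2\<bar> / (b * e\<^sup>2)"
      using be b that by (subst abs_div_pos) (auto simp: diff_divide_distrib)
    moreover have "C2 * e ^ 3 / (b * e\<^sup>2) = C2 / b * e"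
      using that by (simp add: power2_eq_square power3_eq_cube)
    ultimately show ?thesis by simp
  qed
  have \<psi>_ratio: "\<psi> (tc - e) / (b * e\<^sup>2) \<in> {1/2..3/2}" if "e \<in> {0<..<e0}" for e
  proof -
    have "C2 * e \<le> C2 * e0"
      using that d2 by (intro mult_left_mono) auto
    then have "C2 / b * e \<le> 1 / 2"
      using C2e0 b by (simp add: field_simps)
    then show ?thesis
      using \<psi>_near[OF that] unfolding abs_le_iff atLeastAtMost_iff by linarith
  qed
  show ?thesis
  proof (rule exI[of _ e0], intro conjI allI impI)
    show "0 < e0" by fact
    fix r :: nat assume r: "2 \<le> r"
    define a where "a = real r - 3 / 2"
    interpret gamma_integrand a
      by unfold_locales (use r in \<open>simp add: a_def\<close>)
    have "0 < a" using a by simp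
    have G: "0 < Gamma a"
      using \<open>0 < a\<close> by (rule Gamma_real_pos)
    let ?B = "susceptibility_constant l K R tc \<theta> \<psi> r"
    have B: "?B = \<theta> tc * b powr (- a) * (Gamma a / real p)"
    proof -
      have "b powr (- a) = deriv (deriv \<psi>) tc powr (- a) * 2 powr a"
        using b by (simp add: b_def powr_divide powr_minus_divide)
      then have "\<theta> tc * b powr (- a) * (Gamma a / real p) =
          \<theta> tc / real p * deriv (deriv \<psi>) tc powr (- a) * (Gamma a * 2 powr a)"
        by (simp add: mult_ac)
      also have "Gamma a * 2 powr a = real_of_int (double_factorial (2 * int r - 5)) * sqrt (2 * pi)"
        unfolding a_def using Gamma_half_integer_double_factorial[OF r] .
      finally have "\<theta> tc * b powr (- a) * (Gamma a / real p) =
          \<theta> tc / real p * deriv (deriv \<psi>) tc powr (- a) *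
            (real_of_int (double_factorial (2 * int r - 5)) * sqrt (2 * pi))" .
      moreover have "- a = - real r + 3 / 2"
        by (simp add: a_def)
      ultimately show ?thesis
        unfolding susceptibility_constant_def p_def by (simp only: mult_ac times_divide_eq_left times_divide_eq_right)
    qed
    show "0 < ?B"
      unfolding B using \<theta>c b p G by simp
    obtain D where D: "0 \<le> D" "\<forall>x>0. \<forall>w. (\<forall>k\<ge>1. \<bar>w k - of_bool (p dvd k)\<bar> \<le> (real k0 + C) / real k) \<longrightarrow>
        summable (\<lambda>k. w k * g (x * real k)) \<and>
        \<bar>x * (\<Sum>k. w k * g (x * real k)) - Gamma a / real p\<bar> \<le> D * sqrt x"
      using riemann_sum_g_multiples[OF p, of "real k0 + C"] by (elim exE conjE)
    obtain L where L: "0 \<le> L" "\<And>w. w \<in> {1/2..3/2} \<Longrightarrow> \<bar>w powr (- a) - 1\<bar> \<le> L * \<bar>w - 1\<bar>"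
      using powr_near_one by blast
    \<comment> \<open>\<open>T\<close> is x = \<psi>(t) times the weighted sum of g(x k): the powers
      of k combine to k^(a-1), and replacing k by x k there costs x^(1-a), of which one factor x is
      the mesh.\<close>
    have sum: "\<exists>T. s r t = \<theta> t * \<psi> t powr (- a) * T \<and> \<bar>T - Gamma a / real p\<bar> \<le> D * sqrt (\<psi> t)"
      if t: "0 \<le> t" "t < tc" "tc - e1 \<le> t" and x: "0 < \<psi> t" for t
    proof -
      have "\<exists>\<eta>. \<forall>k\<ge>1. \<bar>\<eta> k\<bar> \<le> C / real k \<and>
          \<rho> k t = (1 + \<eta> k) * indicator (attainable_sizes l K R) k *
            real k powr (- 3 / 2) * \<theta> t * exp (- \<psi> t * real k)"
        using \<rho> t by (intro choice) auto
      then obtain \<eta> where \<eta>: "\<And>k. 1 \<le> k \<Longrightarrow> \<bar>\<eta> k\<bar> \<le> C / real k"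
        "\<And>k. 1 \<le> k \<Longrightarrow> \<rho> k t = (1 + \<eta> k) * indicator (attainable_sizes l K R) k *
            real k powr (- 3 / 2) * \<theta> t * exp (- \<psi> t * real k)"
        by blast
      define w where "w = (\<lambda>k. (1 + \<eta> k) * indicator (attainable_sizes l K R) k)"
      have w: "\<bar>w k - of_bool (p dvd k)\<bar> \<le> (real k0 + C) / real k" if "1 \<le> k" for k
      proof -
        have "w k - of_bool (p dvd k) = (indicator (attainable_sizes l K R) k - of_bool (p dvd k)) +
            \<eta> k * indicator (attainable_sizes l K R) k"
          by (simp add: w_def algebra_simps)
        moreover have "\<bar>\<eta> k * indicator (attainable_sizes l K R) k\<bar> \<le> \<bar>\<eta> k\<bar>"
          by (simp add: indicator_def)
        ultimately show ?thesis
          using k0[OF that] \<eta>(1)[OF that] unfolding add_divide_distrib by linarith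
      qed
      define \<Sigma> where "\<Sigma> = (\<Sum>k. w k * g (\<psi> t * real k))"
      have \<Sigma>: "(\<lambda>k. w k * g (\<psi> t * real k)) sums \<Sigma>" "\<bar>\<psi> t * \<Sigma> - Gamma a / real p\<bar> \<le> D * sqrt (\<psi> t)"
        using D(2)[rule_format, OF x w] unfolding \<Sigma>_def by (auto intro: summable_sums)
      have "real k ^ (r - 1) * \<rho> k t = \<theta> t * \<psi> t powr (- a) * \<psi> t * (w k * g (\<psi> t * real k))" for k
      proof (cases "k = 0")
        case True
        then show ?thesis using r by (simp add: g_0)
      next
        case False
        have "real k ^ (r - 1) * real k powr (- 3 / 2) = real k powr (a - 1)"
          using False r by (simp add: powr_realpow[symmetric] powr_add[symmetric] a_def of_nat_diff)
        moreover have "\<psi> t powr (- a) * \<psi> t * \<psi> t powr (a - 1) = 1"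
          using x by (simp add: powr_diff powr_minus)
        then have "\<psi> t powr (- a) * \<psi> t * g (\<psi> t * real k) = real k powr (a - 1) * exp (- \<psi> t * real k)"
          using x by (simp add: g_def powr_mult)
        ultimately show ?thesis
          using \<eta>(2)[of k] False by (simp add: w_def mult_ac)
      qed
      then have "(\<lambda>k. real k ^ (r - 1) * \<rho> k t) sums (\<theta> t * \<psi> t powr (- a) * \<psi> t * \<Sigma>)"
        using sums_mult[OF \<Sigma>(1)] by simp
      moreover have "(\<lambda>k. real k ^ (r - 1) * \<rho> k t) sums s r t"
        using limit_susceptibility_sums assms(1,3,4) r t(1,2) .
      ultimately have "s r t = \<theta> t * \<psi> t powr (- a) * (\<psi> t * \<Sigma>)"
        using sums_unique2 by (simp add: mult.assoc) blast
      then show ?thesis using \<Sigma>(2) by blast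
    qed
    \<comment> \<open>\<open>M\<close> is D sqrt x relative to the limit Gamma(a)/p, using x \<le> 2
      b e^2. \<open>Q\<close> is the constant of \<open>mult_near_one\<close> for the factors coming
      from \<theta> and from the power of \<psi>.\<close>
    define M where "M = real p / Gamma a * (D * sqrt (2 * b))"
    define Q where "Q = C1 / \<theta> tc + L * (C2 / b) + C1 / \<theta> tc * (L * (C2 / b)) * e0"
    have nonneg: "0 \<le> C1 / \<theta> tc" "0 \<le> L * (C2 / b)" "0 \<le> M" "0 \<le> Q"
      unfolding M_def Q_def using d1 d2 L D \<theta>c b p G e0 by auto
    show "\<exists>C. \<forall>e\<in>{0<..<e0}. \<exists>\<eta>. \<bar>\<eta>\<bar> \<le> C * e \<and> s r (tc - e) = (1 + \<eta>) * ?B * e powi (- 2 * int r + 3)"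
    proof (rule exI[of _ "Q + M + Q * M * e0"], rule ballI)
      fix e assume e: "e \<in> {0<..<e0}"
      then have e': "0 \<le> e" "e \<le> e0" by auto
      define x where "x = \<psi> (tc - e)"
      define y where "y = x / (b * e\<^sup>2)"
      have be: "0 < b * e\<^sup>2"
        using e b by simp
      have y: "y \<in> {1/2..3/2}"
        unfolding y_def x_def using \<psi>_ratio[OF e] .
      then have x: "x = b * e\<^sup>2 * y" "0 < x"
        using be by (auto simp: y_def zero_less_divide_iff)
      obtain T where T: "s r (tc - e) = \<theta> (tc - e) * x powr (- a) * T" "\<bar>T - Gamma a / real p\<bar> \<le> D * sqrt x"
        using sum[of "tc - e"] e e0 x(2) unfolding x_def by auto
      have x_powr: "x powr (- a) = b powr (- a) * e powi (- 2 * int r + 3) * y powr (- a)"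
      proof -
        have "e\<^sup>2 = e powr 2"
          using e by simp
        then have "(e\<^sup>2) powr (- a) = e powr (2 * (- a))"
          by (simp only: powr_powr)
        also have "\<dots> = e powr (real_of_int (- 2 * int r + 3))"
          by (simp add: a_def algebra_simps)
        also have "\<dots> = e powi (- 2 * int r + 3)"
          using e by (intro powr_real_of_int') auto
        finally show ?thesis
          unfolding x(1) using b e y by (simp add: powr_mult)
      qed
      have T_near: "\<bar>real p / Gamma a * T - 1\<bar> \<le> M * e"
      proof -
        \<comment> \<open>The error O(sqrt x) becomes O(e) here; y \<le> 3/2 is rounded up to
          2.\<close>
        have "sqrt x \<le> sqrt (b * e\<^sup>2 * 2)"
          unfolding x(1) using y be by (intro real_sqrt_le_mono mult_left_mono) auto
        also have "\<dots> = sqrt (2 * b) * e"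
          using e by (simp add: real_sqrt_mult)
        finally have "D * sqrt x \<le> D * (sqrt (2 * b) * e)"
          using D(1) by (rule mult_left_mono)
        then have "real p / Gamma a * \<bar>T - Gamma a / real p\<bar> \<le> real p / Gamma a * (D * (sqrt (2 * b) * e))"
          using T(2) G by (intro mult_left_mono) auto
        moreover have "\<bar>real p / Gamma a * T - 1\<bar> = \<bar>real p / Gamma a * (T - Gamma a / real p)\<bar>"
          using p G by (simp add: right_diff_distrib)
        ultimately show ?thesis
          using G by (simp add: abs_mult M_def mult.assoc)
      qed
      have y_near: "\<bar>y powr (- a) - 1\<bar> \<le> L * (C2 / b) * e"
      proof -
        have "L * \<bar>y - 1\<bar> \<le> L * (C2 / b * e)"
          using \<psi>_near[OF e] L(1) unfolding y_def x_def by (intro mult_left_mono) auto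
        then show ?thesis using L(2)[OF y] by simp
      qed
      \<comment> \<open>The ratio of s_r(tc - e) to the claimed main term, split into three factors
        close to 1.\<close>
      let ?E = "\<theta> (tc - e) / \<theta> tc * y powr (- a) * (real p / Gamma a * T)"
      have "\<bar>\<theta> (tc - e) / \<theta> tc * y powr (- a) - 1\<bar> \<le> Q * e"
        unfolding Q_def by (rule mult_near_one[OF nonneg(1,2) e' \<theta>_near[OF e] y_near])
      then have "\<bar>?E - 1\<bar> \<le> (Q + M + Q * M * e0) * e"
        by (rule mult_near_one[OF nonneg(4,3) e' _ T_near])
      moreover have "s r (tc - e) = (1 + (?E - 1)) * ?B * e powi (- 2 * int r + 3)"
        unfolding T(1) x_powr B using \<theta>c p G by simp
      ultimately show "\<exists>\<eta>. \<bar>\<eta>\<bar> \<le> (Q + M + Q * M * e0) * e \<and> s r (tc - e) = (1 + \<eta>) * ?B * e powi (- 2 * int r + 3)"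
        by blast
    qed
  qed
qed

end
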